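(* (a) There are elements $a^\lambda_{w,v}, b^\lambda_{w,v}\in\mathcal Q$ ($w,v\in W$, $v\le w$ in the Bruhat order; put $a^\lambda_{w,v}=b^\lambda_{w,v}=0$ if $v\not\le w$) such that for every $w\in W$ $$T^{\lambda}_w=\sum_{v\le w}a^{\lambda}_{w,v}\,\delta_w^{\mathrm d}\delta_v,\qquad \delta_w=\sum_{v\le w}b_{w,v}^{\lambda}\,\delta^{\mathrm d}_{v^{-1}}T_v^{\lambda},$$ and these coefficients satisfy, for all $w,u\in W$, $$\sum_{v\in W}a^{\lambda}_{w,v}\cdot{}^{w^{\mathrm d}}b^{\lambda}_{v,u}=\delta^{\mathrm{Kr}}_{w,u},\qquad \sum_{v\in W}b^{\lambda}_{w,v}\cdot{}^{(v^{-1})^{\mathrm d}}a^{\lambda}_{v,u}=\delta^{\mathrm{Kr}}_{w,u},$$ where $\delta^{\mathrm{Kr}}$ is the Kronecker symbol. Moreover, for every $w\in W$, $$a^{\lambda}_{w,w}=\prod_{\alpha\in \Sigma_w}\frac{\theta(\hbar-z_\alpha)\theta(\lambda_{\alpha^\vee})}{\theta(z_\alpha)\theta(\hbar-\lambda_{\alpha^\vee})},\qquad b^\lambda_{w,w}=\prod_{\alpha\in \Sigma_w}\frac{\theta(z_\alpha)}{\theta(\hbar-z_\alpha)}\cdot{}^{(w^{-1})^{\mathrm d}}\!\left(\frac{\theta(\hbar-\lambda_{\alpha^\vee})}{\theta(\lambda_{\alpha^\vee})}\right),$$ where $\Sigma_w=\{\alpha>0\mid w^{-1}\alpha<0\}$.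 (b) The set $\{T_w^\lambda\mid w\in W\}$ is a basis of the left $\mathcal Q_{W^{\mathrm d}}$-module $\mathcal Q_{W^{\mathrm d}\times W}$.
   Context: Setting. $G$ is a reductive group over $\mathbb C$ with Borel subgroup $B$ and maximal torus $T$; $X^*(T)$, $X_*(T)$ are the character and cocharacter groups, $\Sigma\subset X^*(T)$ the roots, $\alpha_1,\dots,\alpha_n$ the simple roots, $\alpha^\vee$ the coroot of $\alpha$, $W$ the Weyl group with simple reflections $s_i=s_{\alpha_i}$. Fix $\tau\in\mathbb C$ with $\operatorname{Im}\tau>0$, $q=e^{2\pi i\tau}$, and let $$\theta(x)=\tfrac{1}{2\pi i}\bigl(e^{\pi i x}-e^{-\pi i x}\bigr)\prod_{s>0}(1-q^se^{2\pi i x})(1-q^se^{-2\pi i x})\prod_{s>0}(1-q^s)^{-2},$$ an odd entire function of $x\in\mathbb C$. Fix $\hbar\in\mathbb C$. $\mathcal Q$ is the field of meromorphic functions of $(z,\lambda)\in (X_*(T)\otimes\mathbb C)\times(X^*(T)\otimes\mathbb C)$. For $\mu\in X^*(T)$, $z_\mu$ is the linear function $z\mapsto\langle\mu,z\rangle$; for $\mu^\vee\in X_*(T)$, $\lambda_{\mu^\vee}$ is the linear function $\lambda\mapsto\langle\lambda,\mu^\vee\rangle$. $W$ acts on $\mathcal Q$ in two commuting ways: through $z$, written ${}^{w}a$ (so ${}^w z_\mu=z_{w\mu}$, $\lambda$ unchanged), and through $\lambda$ (the dynamical action), written ${}^{w^{\mathrm d}}a$ (so ${}^{w^{\mathrm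 d}}\lambda_{\mu^\vee}=\lambda_{w\mu^\vee}$, $z$ unchanged). $\mathcal Q_{W^{\mathrm d}}$ is the twisted group algebra: the free left $\mathcal Q$-module with basis $\delta^{\mathrm d}_w$, $w\in W$. $\mathcal Q_{W^{\mathrm d}\times W}$ is the free left $\mathcal Q_{W^{\mathrm d}}$-module with basis $\delta_w$, $w\in W$. The product is $\delta_w\delta_v^{\mathrm d}=\delta_v^{\mathrm d}\delta_w$ and $(a\delta^{\mathrm d}_w\delta_v)(a'\delta^{\mathrm d}_{w'}\delta_{v'})=a\cdot{}^{v w^{\mathrm d}}a'\,\delta^{\mathrm d}_{ww'}\delta_{vv'}$ for $a,a'\in\mathcal Q$. Elliptic Demazure–Lusztig operators. For a simple root $\alpha$, $$T_{\alpha}^{\lambda}=\frac{\theta(\hbar-z_\alpha)\theta(\lambda_{\alpha^\vee})}{\theta(z_\alpha)\theta(\hbar-\lambda_{\alpha^\vee})}\delta_{s_\alpha} \delta_{s_\alpha}^{\mathrm d}+\frac{\theta(\hbar)\theta(z_\alpha-\lambda_{\alpha^\vee})}{\theta(z_\alpha)\theta(\hbar-\lambda_{\alpha^\vee})}\delta_{s_\alpha}^{\mathrm d}\in\mathcal Q_{W^{\mathrm d}\times W},\qquad T_i^\lambda=T_{\alpha_i}^\lambda.$$ It is known that $(T_\alpha^\lambda)^2=1$ and that the $T_i^\lambda$ satisfy the braid relations of $W$; hence $T_w^\lambda:=T_{i_1}^\lambda\cdots T_{i_k}^\lambda$ for a reduced decomposition $w=s_{i_1}\cdots s_{i_k}$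 is well defined. *)

theory Defs
  imports "HOL-Complex_Analysis.Complex_Analysis" "HOL-Library.Function_Algebras"
begin

section \<open>Meromorphic functions in several complex variables\<close>

type_synonym 'n cspace = "(complex ^ 'n) \<times> (complex ^ 'n)"

definition cscale :: "complex \<Rightarrow> ('n::finite) cspace \<Rightarrow> 'n cspace" where
  "cscale c p = (c *s fst p, c *s snd p)"

definition mholomorphic_on :: "(('n::finite) cspace \<Rightarrow> complex) \<Rightarrow> 'n cspace set \<Rightarrow> bool" where
  "mholomorphic_on f U \<longleftrightarrow>
     (\<forall>p\<in>U. \<exists>D. (f has_derivative D) (at p) \<and> (\<forall>c v. D (cscale c v) = c * D v))"

definition is_quotient_on ::
  "(('n::finite) cspace \<Rightarrow> complex) \<Rightarrow> 'n cspace set \<Rightarrow> ('n cspace \<Rightarrow> complex) \<Rightarrow> ('n cspace \<Rightarrow> complex) \<Rightarrow> bool" where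
  "is_quotient_on f U g h \<longleftrightarrow>
     open U \<and> mholomorphic_on g U \<and> mholomorphic_on h U \<and>
     (\<forall>V. open V \<longrightarrow> V \<noteq> {} \<longrightarrow> V \<subseteq> U \<longrightarrow> (\<exists>x\<in>V. h x \<noteq> 0)) \<and>
     (\<forall>x\<in>U. h x \<noteq> 0 \<longrightarrow> f x = g x / h x)"

text \<open>
  A meromorphic function is locally a quotient \<open>g / h\<close> of holomorphic functions with \<open>h\<close> vanishing
  identically on no nonempty open set. It is represented by a total function whose values on the
  polar set are arbitrary; representatives are identified if they agree on a dense open set.
\<close>

definition meromorphic_rep :: "(('n::finite) cspace \<Rightarrow> complex) \<Rightarrow> bool" where
  "meromorphic_rep f \<longleftrightarrow> (\<forall>p. \<exists>U g h. p \<in> U \<and> is_quotient_on f U g h)"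

definition generic_eq :: "(('n::finite) cspace \<Rightarrow> complex) \<Rightarrow> ('n cspace \<Rightarrow> complex) \<Rightarrow> bool" where
  "generic_eq f g \<longleftrightarrow> (\<exists>S. open S \<and> closure S = UNIV \<and> (\<forall>x\<in>S. f x = g x))"

definition mero_rel :: "(('n::finite) cspace \<Rightarrow> complex) \<Rightarrow> ('n cspace \<Rightarrow> complex) \<Rightarrow> bool" where
  "mero_rel f g \<longleftrightarrow> meromorphic_rep f \<and> meromorphic_rep g \<and> generic_eq f g"

lemma dense_Int:
  assumes "open S" "closure S = UNIV" "closure T = UNIV"
  shows "closure (S \<inter> T) = UNIV"
proof -
  have "S \<inter> closure T \<subseteq> closure (S \<inter> T)"
    using open_Int_closure_subset[OF assms(1)] .
  hence "closure S \<subseteq> closure (S \<inter> T)"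
    using assms by (metis Int_UNIV_right closure_closure closure_mono)
  thus ?thesis using assms by auto
qed

lemma generic_eq_refl: "generic_eq f f"
  unfolding generic_eq_def by (rule exI[of _ UNIV]) auto

lemma generic_eq_sym: "generic_eq f g \<Longrightarrow> generic_eq g f"
  unfolding generic_eq_def by (metis (no_types))

lemma generic_eq_combine:
  assumes "generic_eq f f'" "generic_eq g g'"
    and "\<And>x. f x = f' x \<Longrightarrow> g x = g' x \<Longrightarrow> k x = k' x"
  shows "generic_eq k k'"
proof -
  obtain S T where "open S" "closure S = UNIV" "\<forall>x\<in>S. f x = f' x"
    "open T" "closure T = UNIV" "\<forall>x\<in>T. g x = g' x"
    using assms(1,2) unfolding generic_eq_def by blast
  thus ?thesis unfolding generic_eq_def
    by (intro exI[of _ "S \<inter> T"]) (auto simp: dense_Int intro!: assms(3))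
qed

lemma generic_eq_trans: "generic_eq f g \<Longrightarrow> generic_eq g h \<Longrightarrow> generic_eq f h"
  by (rule generic_eq_combine[of f g g h]) auto

lemma mholomorphic_on_subset: "mholomorphic_on f U \<Longrightarrow> V \<subseteq> U \<Longrightarrow> mholomorphic_on f V"
  unfolding mholomorphic_on_def by blast

lemma mholomorphic_on_const: "mholomorphic_on (\<lambda>_. c) U"
  unfolding mholomorphic_on_def by (intro ballI exI[of _ "\<lambda>_. 0"]) auto

lemma mholomorphic_on_add:
  "mholomorphic_on f U \<Longrightarrow> mholomorphic_on g U \<Longrightarrow> mholomorphic_on (\<lambda>x. f x + g x) U"
  unfolding mholomorphic_on_def
proof (intro ballI)
  fix p assume *: "\<forall>p\<in>U. \<exists>D. (f has_derivative D) (at p) \<and> (\<forall>c v. D (cscale c v) = c * D v)"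
    "\<forall>p\<in>U. \<exists>D. (g has_derivative D) (at p) \<and> (\<forall>c v. D (cscale c v) = c * D v)" "p \<in> U"
  then obtain D E where "(f has_derivative D) (at p)" "\<forall>c v. D (cscale c v) = c * D v"
    "(g has_derivative E) (at p)" "\<forall>c v. E (cscale c v) = c * E v" by blast
  thus "\<exists>D. ((\<lambda>x. f x + g x) has_derivative D) (at p) \<and> (\<forall>c v. D (cscale c v) = c * D v)"
    by (intro exI[of _ "\<lambda>v. D v + E v"] conjI) (simp_all add: has_derivative_add ring_distribs)
qed

lemma mholomorphic_on_mult:
  "mholomorphic_on f U \<Longrightarrow> mholomorphic_on g U \<Longrightarrow> mholomorphic_on (\<lambda>x. f x * g x) U"
  unfolding mholomorphic_on_def
proof (intro ballI)
  fix p assume *: "\<forall>p\<in>U. \<exists>D. (f has_derivative D) (at p) \<and> (\<forall>c v. D (cscale c v) = c * D v)"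
    "\<forall>p\<in>U. \<exists>D. (g has_derivative D) (at p) \<and> (\<forall>c v. D (cscale c v) = c * D v)" "p \<in> U"
  then obtain D E where "(f has_derivative D) (at p)" "\<forall>c v. D (cscale c v) = c * D v"
    "(g has_derivative E) (at p)" "\<forall>c v. E (cscale c v) = c * E v" by blast
  thus "\<exists>D. ((\<lambda>x. f x * g x) has_derivative D) (at p) \<and> (\<forall>c v. D (cscale c v) = c * D v)"
    by (intro exI[of _ "\<lambda>v. f p * E v + D v * g p"] conjI)
      (simp_all add: has_derivative_mult ring_distribs mult.assoc mult.left_commute)
qed

lemma mholomorphic_on_minus: "mholomorphic_on f U \<Longrightarrow> mholomorphic_on (\<lambda>x. - f x) U"
  using mholomorphic_on_mult[OF mholomorphic_on_const[of "-1"], of f U] by simp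

lemma mholomorphic_on_isCont: "mholomorphic_on f U \<Longrightarrow> x \<in> U \<Longrightarrow> isCont f x"
  unfolding mholomorphic_on_def using has_derivative_continuous by blast

lemma mholomorphic_on_compose:
  assumes "f holomorphic_on UNIV" "mholomorphic_on u U"
  shows "mholomorphic_on (\<lambda>p. f (u p)) U"
  unfolding mholomorphic_on_def
proof (intro ballI)
  fix p assume "p \<in> U"
  then obtain D where D: "(u has_derivative D) (at p)" "\<forall>c v. D (cscale c v) = c * D v"
    using assms(2) unfolding mholomorphic_on_def by blast
  have "(f has_field_derivative deriv f (u p)) (at (u p))"
    using assms(1) holomorphic_derivI[of f UNIV] by auto
  hence "(f has_derivative (*) (deriv f (u p))) (at (u p))"
    by (simp add: has_field_derivative_def)
  from has_derivative_compose[OF D(1) this]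
  show "\<exists>D. ((\<lambda>p. f (u p)) has_derivative D) (at p) \<and> (\<forall>c v. D (cscale c v) = c * D v)"
    by (intro exI[of _ "\<lambda>v. deriv f (u p) * D v"] conjI) (simp_all add: D(2) mult.left_commute)
qed

lemma open_nonzero_set:
  assumes "mholomorphic_on h U" "open U"
  shows "open {x\<in>U. h x \<noteq> 0}"
proof -
  have "continuous_on U h"
    using mholomorphic_on_isCont[OF assms(1)] by (simp add: continuous_at_imp_continuous_on)
  hence "open (U \<inter> h -` (- {0}))"
    using assms(2) by (intro continuous_open_preimage) auto
  moreover have "U \<inter> h -` (- {0}) = {x\<in>U. h x \<noteq> 0}" by auto
  ultimately show ?thesis by simp
qed

lemma is_quotient_on_mono:
  "is_quotient_on f U g h \<Longrightarrow> open V \<Longrightarrow> V \<subseteq> U \<Longrightarrow> is_quotient_on f V g h"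
  unfolding is_quotient_on_def by (auto intro: mholomorphic_on_subset)

lemma is_quotient_on_pt:
  assumes "is_quotient_on f U g h" "open V" "V \<noteq> {}" "V \<subseteq> U"
  obtains x where "x \<in> V" "h x \<noteq> 0"
  using assms unfolding is_quotient_on_def by metis

lemma is_quotient_on_pt2:
  assumes 1: "is_quotient_on f U g h" and 2: "is_quotient_on f' U' g' h'"
    and V: "open V" "V \<noteq> {}" "V \<subseteq> U" "V \<subseteq> U'"
  obtains x where "x \<in> V" "h x \<noteq> 0" "h' x \<noteq> 0"
proof -
  have "mholomorphic_on h V" using 1 V unfolding is_quotient_on_def
    by (auto intro: mholomorphic_on_subset)
  hence o: "open {x\<in>V. h x \<noteq> 0}" using V open_nonzero_set by blast
  obtain y where "y \<in> V" "h y \<noteq> 0" using is_quotient_on_pt[OF 1] V by metis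
  hence "{x\<in>V. h x \<noteq> 0} \<noteq> {}" by blast
  from is_quotient_on_pt[OF 2 o this] V that show ?thesis by blast
qed

lemma meromorphic_rep_holomorphic:
  assumes "mholomorphic_on f UNIV" shows "meromorphic_rep f"
  unfolding meromorphic_rep_def is_quotient_on_def
  using assms mholomorphic_on_const[of 1 UNIV]
  by (intro allI exI[of _ UNIV] exI[of _ f] exI[of _ "\<lambda>_. 1"]) auto

lemma meromorphic_rep_const: "meromorphic_rep (\<lambda>_. c)"
  by (intro meromorphic_rep_holomorphic mholomorphic_on_const)

lemma meromorphic_rep_binary:
  assumes "meromorphic_rep f" "meromorphic_rep f'"
    and "\<And>U g h g' h'. mholomorphic_on g U \<Longrightarrow> mholomorphic_on h U \<Longrightarrow> mholomorphic_on g' U \<Longrightarrow>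
           mholomorphic_on h' U \<Longrightarrow> mholomorphic_on (N g h g' h') U"
    and "\<And>g h g' h' x. h x \<noteq> 0 \<Longrightarrow> h' x \<noteq> 0 \<Longrightarrow> f x = g x / h x \<Longrightarrow> f' x = g' x / h' x \<Longrightarrow>
           k x = N g h g' h' x / (h x * h' x)"
  shows "meromorphic_rep k"
  unfolding meromorphic_rep_def
proof
  fix p
  obtain U g h U' g' h' where q: "p \<in> U" "is_quotient_on f U g h" "p \<in> U'" "is_quotient_on f' U' g' h'"
    using assms(1,2) unfolding meromorphic_rep_def by metis
  let ?U = "U \<inter> U'"
  have o: "open ?U" using q unfolding is_quotient_on_def by auto
  have 1: "is_quotient_on f ?U g h" "is_quotient_on f' ?U g' h'"
    using is_quotient_on_mono[OF q(2) o] is_quotient_on_mono[OF q(4) o] by auto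
  have "is_quotient_on k ?U (N g h g' h') (\<lambda>x. h x * h' x)"
    unfolding is_quotient_on_def
  proof (intro conjI allI impI ballI)
    show "mholomorphic_on (N g h g' h') ?U"
      using 1 unfolding is_quotient_on_def by (intro assms(3)) auto
    show "mholomorphic_on (\<lambda>x. h x * h' x) ?U"
      using 1 unfolding is_quotient_on_def by (intro mholomorphic_on_mult) auto
    fix V assume "open V" "V \<noteq> {}" "V \<subseteq> ?U"
    then obtain x where "x \<in> V" "h x \<noteq> 0" "h' x \<noteq> 0" using is_quotient_on_pt2[OF 1] by metis
    thus "\<exists>x\<in>V. h x * h' x \<noteq> 0" by auto
  next
    fix x assume "x \<in> ?U" "h x * h' x \<noteq> 0"
    thus "k x = N g h g' h' x / (h x * h' x)"
      using 1 unfolding is_quotient_on_def by (intro assms(4)) auto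
  qed (rule o)
  thus "\<exists>U g h. p \<in> U \<and> is_quotient_on k U g h" using q by blast
qed

lemma meromorphic_rep_add:
  assumes "meromorphic_rep f" "meromorphic_rep g" shows "meromorphic_rep (\<lambda>x. f x + g x)"
  by (rule meromorphic_rep_binary[OF assms, where N = "\<lambda>g h g' h' x. g x * h' x + g' x * h x"])
    (auto intro!: mholomorphic_on_add mholomorphic_on_mult simp: field_simps)

lemma meromorphic_rep_mult:
  assumes "meromorphic_rep f" "meromorphic_rep g" shows "meromorphic_rep (\<lambda>x. f x * g x)"
  by (rule meromorphic_rep_binary[OF assms, where N = "\<lambda>g h g' h' x. g x * g' x"])
    (auto intro!: mholomorphic_on_mult)

lemma meromorphic_rep_minus: "meromorphic_rep f \<Longrightarrow> meromorphic_rep (\<lambda>x. - f x)"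
  using meromorphic_rep_mult[OF meromorphic_rep_const[of "-1"], of f] by simp

lemma identity_theorem_ball:
  assumes g: "mholomorphic_on g (ball a r)" and V: "open V" "V \<noteq> {}" "V \<subseteq> ball a r"
    and z: "\<forall>x\<in>V. g x = 0" and x: "x \<in> ball a r"
  shows "g x = 0"
proof -
  obtain v where v: "v \<in> V" using V by auto
  define L where "L = (\<lambda>t. v + cscale t (x - v))"
  have linL: "bounded_linear (\<lambda>t. cscale t (x - v))"
    unfolding linear_conv_bounded_linear[symmetric]
    by (rule linearI) (auto simp: cscale_def vec_eq_iff algebra_simps prod_eq_iff)
  have dL: "(L has_derivative (\<lambda>t. cscale t (x - v))) (at t)" for t
    unfolding L_def using bounded_linear_imp_has_derivative[OF linL]
    by (auto intro!: derivative_eq_intros)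
  have cL: "continuous_on UNIV L"
    by (intro continuous_at_imp_continuous_on ballI has_derivative_continuous[OF dL])
  define S where "S = L -` ball a r"
  have oS: "open S" unfolding S_def using cL by (intro open_vimage) auto
  have affL: "L ((1 - u) *\<^sub>R s + u *\<^sub>R t) = (1 - u) *\<^sub>R L s + u *\<^sub>R L t" for u s t
  proof -
    have "cscale ((1 - u) *\<^sub>R s + u *\<^sub>R t) (x - v) =
        (1 - u) *\<^sub>R cscale s (x - v) + u *\<^sub>R cscale t (x - v)"
      by (auto simp: cscale_def vec_eq_iff algebra_simps prod_eq_iff)
    thus ?thesis unfolding L_def by (simp add: algebra_simps)
  qed
  have "convex S" unfolding convex_alt
  proof (intro ballI allI impI)
    fix s t and u :: real assume "s \<in> S" "t \<in> S" "0 \<le> u \<and> u \<le> 1"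
    thus "(1 - u) *\<^sub>R s + u *\<^sub>R t \<in> S" unfolding S_def
      using convex_ball[of a r] by (auto simp: affL convex_alt simp del: mem_ball)
  qed
  hence cS: "connected S" by (rule convex_connected)
  define T where "T = L -` V"
  have oT: "open T" unfolding T_def using cL V by (intro open_vimage) auto
  have "L 0 = v" "L 1 = x" by (simp_all add: L_def cscale_def prod_eq_iff)
  hence TS: "0 \<in> T" "1 \<in> S" "T \<subseteq> S" using v x V unfolding T_def S_def by auto
  have "(g \<circ> L) holomorphic_on S"
  proof (rule holomorphic_onI)
    fix t assume "t \<in> S"
    then obtain D where D: "(g has_derivative D) (at (L t))" "\<forall>c v. D (cscale c v) = c * D v"
      using g unfolding mholomorphic_on_def S_def by blast
    have "(g \<circ> L has_derivative D \<circ> (\<lambda>t. cscale t (x - v))) (at t)"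
      using D(1) dL by (rule diff_chain_at[rotated])
    moreover have "D \<circ> (\<lambda>t. cscale t (x - v)) = (*) (D (x - v))"
      by (rule ext) (simp add: D(2) mult.commute)
    ultimately have "((g \<circ> L) has_field_derivative D (x - v)) (at t)"
      by (simp add: has_field_derivative_def)
    thus "(g \<circ> L) field_differentiable at t within S"
      unfolding field_differentiable_def using has_field_derivative_at_within by blast
  qed
  from analytic_continuation_open[OF oT oS _ cS TS(3) this holomorphic_on_const[of 0], of 1]
  have "(g \<circ> L) 1 = 0" using TS z unfolding T_def by auto
  thus ?thesis using \<open>L 1 = x\<close> by simp
qed

lemma is_quotient_on_num_zero:
  assumes f: "is_quotient_on f U g h" and f': "is_quotient_on f U' g' h'"
    and z: "\<forall>x\<in>U'. g' x = 0" and x: "x \<in> U" "x \<in> U'"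
  shows "g x = 0"
proof (rule ccontr)
  assume "g x \<noteq> 0"
  let ?V = "U' \<inter> {y\<in>U. g y \<noteq> 0}"
  have "open ?V" using open_nonzero_set[of g U] f f' unfolding is_quotient_on_def by blast
  moreover have "?V \<noteq> {}" using x \<open>g x \<noteq> 0\<close> by auto
  ultimately obtain y where y: "y \<in> ?V" "h y \<noteq> 0" "h' y \<noteq> 0"
    using is_quotient_on_pt2[OF f f', of ?V] by auto
  have "f y = g y / h y" "f y = 0" using y f f' z unfolding is_quotient_on_def by auto
  thus False using y by auto
qed

lemma meromorphic_rep_dichotomy:
  assumes f: "meromorphic_rep f" and nz: "\<not> generic_eq f (\<lambda>_. 0)"
    and q: "is_quotient_on f U g h" and V: "open V" "V \<noteq> {}" "V \<subseteq> U"
  shows "\<exists>x\<in>V. g x \<noteq> 0"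
proof (rule ccontr)
  assume g0: "\<not> (\<exists>x\<in>V. g x \<noteq> 0)"
  define Z where "Z = {p. \<exists>U g h. p \<in> U \<and> is_quotient_on f U g h \<and> (\<forall>x\<in>U. g x = 0)}"
  have "open Z"
  proof (subst open_subopen, intro ballI)
    fix p assume "p \<in> Z"
    then obtain U g h where u: "p \<in> U" "is_quotient_on f U g h" "\<forall>x\<in>U. g x = 0"
      unfolding Z_def by blast
    moreover from u(2,3) have "U \<subseteq> Z" unfolding Z_def by blast
    moreover from u(2) have "open U" by (simp add: is_quotient_on_def)
    ultimately show "\<exists>T. open T \<and> p \<in> T \<and> T \<subseteq> Z" by blast
  qed
  moreover have "closed Z"
    unfolding closure_subset_eq[symmetric]
  proof
    fix p assume p: "p \<in> closure Z"
    obtain U g h where q: "p \<in> U" "is_quotient_on f U g h"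
      using f unfolding meromorphic_rep_def by blast
    then obtain r where r: "r > 0" "ball p r \<subseteq> U"
      unfolding is_quotient_on_def using open_contains_ball by metis
    have qb: "is_quotient_on f (ball p r) g h" using is_quotient_on_mono[OF q(2) _ r(2)] by auto
    have "p \<in> ball p r \<inter> closure Z" using p r(1) by simp
    hence "ball p r \<inter> Z \<noteq> {}" using open_Int_closure_eq_empty[of "ball p r" Z] by blast
    then obtain z U' g' h' where z: "z \<in> ball p r" "z \<in> U'" "is_quotient_on f U' g' h'"
      "\<forall>x\<in>U'. g' x = 0" unfolding Z_def by blast
    have "\<forall>x\<in>ball p r \<inter> U'. g x = 0" using is_quotient_on_num_zero[OF qb z(3,4)] by auto
    moreover have "open (ball p r \<inter> U')" using z unfolding is_quotient_on_def by auto
    ultimately have "\<forall>x\<in>ball p r. g x = 0"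
      using identity_theorem_ball[of g p r "ball p r \<inter> U'"] z(1,2) qb
      by (auto simp: is_quotient_on_def simp del: mem_ball split_paired_All)
    moreover have "p \<in> ball p r" using r(1) by simp
    ultimately show "p \<in> Z" unfolding Z_def using qb by blast
  qed
  moreover have "Z \<noteq> {}"
    using V g0 is_quotient_on_mono[OF q V(1,3)] unfolding Z_def by blast
  ultimately have ZU: "Z = UNIV" using clopen[of Z] by blast
  define S where "S = \<Union> {{x\<in>U. h x \<noteq> 0} | U g h. is_quotient_on f U g h \<and> (\<forall>x\<in>U. g x = 0)}"
  have "open S" unfolding S_def is_quotient_on_def
    by (rule open_Union) (use open_nonzero_set in blast)
  moreover have "closure S = UNIV"
  proof (rule ccontr)
    assume "closure S \<noteq> UNIV"
    then obtain p where p: "p \<notin> closure S" by auto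
    obtain U g h where u: "p \<in> U" "is_quotient_on f U g h" "\<forall>x\<in>U. g x = 0"
      using ZU unfolding Z_def by blast
    have "open (U - closure S)" using u unfolding is_quotient_on_def by auto
    then obtain x where "x \<in> U - closure S" "h x \<noteq> 0"
      using is_quotient_on_pt[OF u(2), of "U - closure S"] p u by blast
    moreover from this have "x \<in> S" unfolding S_def using u by blast
    ultimately show False using closure_subset by blast
  qed
  moreover have "\<forall>x\<in>S. f x = 0" unfolding S_def is_quotient_on_def by auto
  ultimately show False using nz unfolding generic_eq_def by blast
qed

lemma meromorphic_rep_nonzero_dense:
  assumes f: "meromorphic_rep f" and nz: "\<not> generic_eq f (\<lambda>_. 0)"
  shows "\<exists>S. open S \<and> closure S = UNIV \<and> (\<forall>x\<in>S. f x \<noteq> 0)"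
proof -
  define S where "S = \<Union> {{x\<in>U. g x \<noteq> 0} \<inter> {x\<in>U. h x \<noteq> 0} | U g h. is_quotient_on f U g h}"
  have "open S" unfolding S_def is_quotient_on_def
    by (rule open_Union) (use open_nonzero_set in blast)
  moreover have "closure S = UNIV"
  proof (rule ccontr)
    assume "closure S \<noteq> UNIV"
    then obtain p where p: "p \<notin> closure S" by auto
    obtain U g h where u: "p \<in> U" "is_quotient_on f U g h"
      using f unfolding meromorphic_rep_def by blast
    have o: "open (U - closure S)" using u unfolding is_quotient_on_def by auto
    then obtain y where y: "y \<in> U - closure S" "g y \<noteq> 0"
      using meromorphic_rep_dichotomy[OF f nz u(2), of "U - closure S"] p u by blast
    let ?V = "{x\<in>U - closure S. g x \<noteq> 0}"
    have "mholomorphic_on g (U - closure S)" using u unfolding is_quotient_on_def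
      by (blast intro: mholomorphic_on_subset)
    hence "open ?V" using o by (rule open_nonzero_set)
    then obtain x where "x \<in> ?V" "h x \<noteq> 0"
      using is_quotient_on_pt[OF u(2), of ?V] y by blast
    moreover from this have "x \<in> S" unfolding S_def using u by blast
    ultimately show False using closure_subset by blast
  qed
  moreover have "\<forall>x\<in>S. f x \<noteq> 0" unfolding S_def is_quotient_on_def by auto
  ultimately show ?thesis by blast
qed

lemma meromorphic_rep_inverse:
  assumes f: "meromorphic_rep f" shows "meromorphic_rep (\<lambda>x. inverse (f x))"
  unfolding meromorphic_rep_def
proof
  fix p
  obtain U g h where q: "p \<in> U" "is_quotient_on f U g h"
    using f unfolding meromorphic_rep_def by blast
  show "\<exists>U g h. p \<in> U \<and> is_quotient_on (\<lambda>x. inverse (f x)) U g h"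
  proof (cases "generic_eq f (\<lambda>_. 0)")
    case True
    then obtain S where S: "open S" "closure S = UNIV" "\<forall>x\<in>S. f x = 0"
      unfolding generic_eq_def by auto
    have "g x = 0" if x: "x \<in> U" for x
    proof (rule ccontr)
      assume "g x \<noteq> 0"
      let ?V = "{y\<in>U. g y \<noteq> 0}"
      have o: "open ?V" using q unfolding is_quotient_on_def by (intro open_nonzero_set) auto
      have "?V \<inter> S \<noteq> {}" using open_Int_closure_eq_empty[OF o, of S] S(2) x \<open>g x \<noteq> 0\<close> by blast
      then obtain y where y: "y \<in> ?V \<inter> S" "h y \<noteq> 0"
        using is_quotient_on_pt[OF q(2), of "?V \<inter> S"] o S(1) by blast
      thus False using q S unfolding is_quotient_on_def by auto
    qed
    hence "is_quotient_on (\<lambda>x. inverse (f x)) U g h"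
      using q unfolding is_quotient_on_def by auto
    thus ?thesis using q by blast
  next
    case False
    have "is_quotient_on (\<lambda>x. inverse (f x)) U (\<lambda>x. h x * h x) (\<lambda>x. g x * h x)"
      unfolding is_quotient_on_def
    proof (intro conjI allI impI ballI)
      fix V assume V: "open V" "V \<noteq> {}" "V \<subseteq> U"
      then obtain y where y: "y \<in> V" "g y \<noteq> 0" using meromorphic_rep_dichotomy[OF f False q(2)] by blast
      have "mholomorphic_on g V" using q V unfolding is_quotient_on_def
        by (blast intro: mholomorphic_on_subset)
      hence "open {y\<in>V. g y \<noteq> 0}" using V(1) by (rule open_nonzero_set)
      then obtain x where "x \<in> {y\<in>V. g y \<noteq> 0}" "h x \<noteq> 0"
        using is_quotient_on_pt[OF q(2), of "{y\<in>V. g y \<noteq> 0}"] y V by blast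
      thus "\<exists>x\<in>V. g x * h x \<noteq> 0" by auto
    qed (use q in \<open>auto simp: is_quotient_on_def intro!: mholomorphic_on_mult\<close>)
    thus ?thesis using q by blast
  qed
qed

quotient_type (overloaded) 'n mero = "(complex ^ ('n::finite)) \<times> (complex ^ 'n) \<Rightarrow> complex" / partial: mero_rel
proof (rule part_equivpI)
  show "\<exists>f. mero_rel f f"
    unfolding mero_rel_def using meromorphic_rep_const generic_eq_refl by blast
  show "symp mero_rel" unfolding mero_rel_def by (auto intro!: sympI generic_eq_sym)
  show "transp mero_rel" unfolding mero_rel_def by (metis (no_types, lifting) transpI generic_eq_trans)
qed

instantiation mero :: (finite) field
begin

lift_definition zero_mero :: "'a mero" is "\<lambda>_. 0"
  unfolding mero_rel_def using meromorphic_rep_const generic_eq_refl by auto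
lift_definition one_mero :: "'a mero" is "\<lambda>_. 1"
  unfolding mero_rel_def using meromorphic_rep_const generic_eq_refl by auto
lift_definition plus_mero :: "'a mero \<Rightarrow> 'a mero \<Rightarrow> 'a mero" is "\<lambda>f g x. f x + g x"
  unfolding mero_rel_def by (auto intro: meromorphic_rep_add elim: generic_eq_combine)
lift_definition times_mero :: "'a mero \<Rightarrow> 'a mero \<Rightarrow> 'a mero" is "\<lambda>f g x. f x * g x"
  unfolding mero_rel_def by (auto intro: meromorphic_rep_mult elim: generic_eq_combine)
lift_definition uminus_mero :: "'a mero \<Rightarrow> 'a mero" is "\<lambda>f x. - f x"
  unfolding mero_rel_def by (auto intro: meromorphic_rep_minus elim!: generic_eq_combine[OF _ generic_eq_refl])
lift_definition inverse_mero :: "'a mero \<Rightarrow> 'a mero" is "\<lambda>f x. inverse (f x)"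
  unfolding mero_rel_def by (auto intro: meromorphic_rep_inverse elim!: generic_eq_combine[OF _ generic_eq_refl])
definition "(a :: 'a mero) - b = a + - b"
definition "(a :: 'a mero) div b = a * inverse b"

instance
proof
  fix a b c :: "'a mero"
  show "a + b + c = a + (b + c)"
    by transfer (auto simp: mero_rel_def add.assoc intro!: meromorphic_rep_add generic_eq_refl)
  show "a + b = b + a"
    by transfer (auto simp: mero_rel_def add.commute intro!: meromorphic_rep_add generic_eq_refl)
  show "0 + a = a" by transfer (auto simp: mero_rel_def)
  show "- a + a = 0"
    by transfer (auto simp: mero_rel_def intro!: meromorphic_rep_const generic_eq_refl)
  show "a - b = a + - b" by (rule minus_mero_def)
  show "a * b * c = a * (b * c)"
    by transfer (auto simp: mero_rel_def mult.assoc intro!: meromorphic_rep_mult generic_eq_refl)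
  show "a * b = b * a"
    by transfer (auto simp: mero_rel_def mult.commute intro!: meromorphic_rep_mult generic_eq_refl)
  show "1 * a = a" by transfer (auto simp: mero_rel_def)
  show "(a + b) * c = a * c + b * c"
    by transfer (auto simp: mero_rel_def distrib_right
        intro!: meromorphic_rep_mult meromorphic_rep_add generic_eq_refl)
  show "(0 :: 'a mero) \<noteq> 1"
  proof transfer
    have "S = {}" if "\<forall>x\<in>S. (0::complex) = 1" for S :: "'a cspace set"
      using that zero_neq_one by blast
    thus "\<not> mero_rel (\<lambda>_ :: 'a cspace. 0) (\<lambda>_. 1)"
      unfolding mero_rel_def generic_eq_def by (metis closure_empty UNIV_not_empty)
  qed
  show "a div b = a * inverse b" by (rule divide_mero_def)
  show "inverse (0 :: 'a mero) = 0"
    by transfer (auto simp: mero_rel_def intro!: meromorphic_rep_const generic_eq_refl)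
  show "a \<noteq> 0 \<Longrightarrow> inverse a * a = 1"
  proof transfer
    fix f :: "'a cspace \<Rightarrow> complex"
    assume f: "mero_rel f f" and n: "\<not> mero_rel f (\<lambda>_. 0)"
    hence m: "meromorphic_rep f" "\<not> generic_eq f (\<lambda>_. 0)"
      unfolding mero_rel_def using meromorphic_rep_const by auto
    obtain S where "open S" "closure S = UNIV" "\<forall>x\<in>S. f x \<noteq> 0"
      using meromorphic_rep_nonzero_dense[OF m] by blast
    hence "generic_eq (\<lambda>x. inverse (f x) * f x) (\<lambda>_. 1)"
      unfolding generic_eq_def by (intro exI[of _ S]) auto
    thus "mero_rel (\<lambda>x. inverse (f x) * f x) (\<lambda>_. 1)"
      unfolding mero_rel_def using m meromorphic_rep_const meromorphic_rep_mult meromorphic_rep_inverse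
      by blast
  qed
qed

end


text \<open>The class of a function; unspecified unless the function satisfies \<^const>\<open>meromorphic_rep\<close>.\<close>

definition mero_fun :: "(('n::finite) cspace \<Rightarrow> complex) \<Rightarrow> 'n mero" where
  "mero_fun f = abs_mero f"

lemma mero_fun_eq_iff:
  assumes "meromorphic_rep f" "meromorphic_rep g"
  shows "mero_fun f = mero_fun g \<longleftrightarrow> generic_eq f g"
  using Quotient3_rel[OF Quotient3_mero, of f g] assms
  by (auto simp: mero_fun_def mero_rel_def generic_eq_refl)

lemma rep_mero_meromorphic: "meromorphic_rep (rep_mero a)"
  using Quotient3_rep_reflp[OF Quotient3_mero, of a] by (simp add: mero_rel_def)

lemma mero_fun_rep_mero: "mero_fun (rep_mero a) = a"
  using Quotient3_abs_rep[OF Quotient3_mero] by (simp add: mero_fun_def)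

lemma generic_eq_rep_mero: "meromorphic_rep f \<Longrightarrow> generic_eq (rep_mero (mero_fun f)) f"
  using mero_fun_eq_iff[OF rep_mero_meromorphic] by (metis mero_fun_rep_mero)


section \<open>Based root data\<close>

definition pairing :: "('a::comm_ring_1) ^ ('n::finite) \<Rightarrow> 'a ^ 'n \<Rightarrow> 'a" where
  "pairing x y = (\<Sum>i\<in>UNIV. x $ i * y $ i)"

text \<open>
  A reductive group with a Borel subgroup and a maximal torus enters through its based root datum.
  A basis of the character lattice and the dual basis of the cocharacter lattice identify both
  lattices with \<open>\<int>\<^sup>n\<close> and the canonical pairing with \<^const>\<open>pairing\<close>. Elements of the Weyl group are
  recorded as integer matrices acting on characters; \<open>w\<close> acts on cocharacters by the transpose
  of \<open>w\<^sup>-\<^sup>1\<close>. In particular \<open>transpose (reflection D \<alpha>)\<close> is the reflection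
  \<open>y \<mapsto> y - \<langle>\<alpha>, y\<rangle> \<alpha>\<^sup>\<or>\<close> of the cocharacter lattice.
\<close>

record ('n::finite) root_datum =
  roots :: "(int ^ 'n) set"
  coroot :: "int ^ 'n \<Rightarrow> int ^ 'n"
  simple_roots :: "(int ^ 'n) set"

definition reflection :: "('n::finite) root_datum \<Rightarrow> int ^ 'n \<Rightarrow> int ^ 'n ^ 'n" where
  "reflection D \<alpha> = mat 1 - (\<chi> i j. \<alpha> $ i * coroot D \<alpha> $ j)"

definition pos_roots :: "('n::finite) root_datum \<Rightarrow> (int ^ 'n) set" where
  "pos_roots D =
     {\<beta> \<in> roots D. \<exists>c :: int ^ 'n \<Rightarrow> nat. \<beta> = (\<Sum>\<alpha>\<in>simple_roots D. int (c \<alpha>) *s \<alpha>)}"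

definition based_root_datum :: "('n::finite) root_datum \<Rightarrow> bool" where
  "based_root_datum D \<longleftrightarrow>
     finite (roots D) \<and> inj_on (coroot D) (roots D) \<and>
     (\<forall>\<alpha>\<in>roots D. pairing \<alpha> (coroot D \<alpha>) = 2) \<and>
     (\<forall>\<alpha>\<in>roots D. \<forall>\<beta>\<in>roots D. reflection D \<alpha> *v \<beta> \<in> roots D) \<and>
     (\<forall>\<alpha>\<in>roots D. \<forall>\<beta>\<in>roots D. transpose (reflection D \<alpha>) *v coroot D \<beta> \<in> coroot D ` roots D) \<and>
     (\<forall>\<alpha>\<in>roots D. 2 *s \<alpha> \<notin> roots D) \<and>
     simple_roots D \<subseteq> roots D \<and>
     (\<forall>c :: int ^ 'n \<Rightarrow> int. (\<Sum>\<alpha>\<in>simple_roots D. c \<alpha> *s \<alpha>) = 0 \<longrightarrow> (\<forall>\<alpha>\<in>simple_roots D. c \<alpha> = 0)) \<and>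
     (\<forall>\<beta>\<in>roots D. \<beta> \<in> pos_roots D \<or> - \<beta> \<in> pos_roots D)"

inductive_set weyl_group :: "('n::finite) root_datum \<Rightarrow> (int ^ 'n ^ 'n) set"
  for D :: "'n root_datum" where
  one: "mat 1 \<in> weyl_group D"
| step: "\<alpha> \<in> roots D \<Longrightarrow> w \<in> weyl_group D \<Longrightarrow> reflection D \<alpha> ** w \<in> weyl_group D"

definition word_prod :: "('n::finite) root_datum \<Rightarrow> (int ^ 'n) list \<Rightarrow> int ^ 'n ^ 'n" where
  "word_prod D \<alpha>s = foldr (\<lambda>\<alpha> w. reflection D \<alpha> ** w) \<alpha>s (mat 1)"

definition weyl_length :: "('n::finite) root_datum \<Rightarrow> int ^ 'n ^ 'n \<Rightarrow> nat" where
  "weyl_length D w =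
     (LEAST k. \<exists>\<alpha>s. set \<alpha>s \<subseteq> simple_roots D \<and> word_prod D \<alpha>s = w \<and> length \<alpha>s = k)"

definition reduced_word :: "('n::finite) root_datum \<Rightarrow> (int ^ 'n) list \<Rightarrow> int ^ 'n ^ 'n \<Rightarrow> bool" where
  "reduced_word D \<alpha>s w \<longleftrightarrow>
     set \<alpha>s \<subseteq> simple_roots D \<and> word_prod D \<alpha>s = w \<and> length \<alpha>s = weyl_length D w"

definition bruhat_step :: "('n::finite) root_datum \<Rightarrow> int ^ 'n ^ 'n \<Rightarrow> int ^ 'n ^ 'n \<Rightarrow> bool" where
  "bruhat_step D v w \<longleftrightarrow>
     (\<exists>\<alpha>\<in>roots D. w = reflection D \<alpha> ** v) \<and> weyl_length D v < weyl_length D w"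

definition bruhat_le :: "('n::finite) root_datum \<Rightarrow> int ^ 'n ^ 'n \<Rightarrow> int ^ 'n ^ 'n \<Rightarrow> bool" where
  "bruhat_le D v w \<longleftrightarrow>
     v \<in> weyl_group D \<and> w \<in> weyl_group D \<and> (bruhat_step D)\<^sup>*\<^sup>* v w"

definition inversions :: "('n::finite) root_datum \<Rightarrow> int ^ 'n ^ 'n \<Rightarrow> (int ^ 'n) set" where
  "inversions D w = {\<alpha> \<in> pos_roots D. - (matrix_inv w *v \<alpha>) \<in> pos_roots D}"


section \<open>The two actions of the Weyl group on meromorphic functions\<close>

text \<open>
  A point of \<^typ>\<open>'n cspace\<close> is a pair \<open>(z, \<lambda>)\<close> with \<open>z\<close> in the complexified cocharacter lattice and
  \<open>\<lambda>\<close> in the complexified character lattice.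
\<close>

definition cvec :: "int ^ ('n::finite) \<Rightarrow> complex ^ 'n" where
  "cvec x = (\<chi> i. of_int (x $ i))"

definition cmat :: "int ^ ('n::finite) ^ 'n \<Rightarrow> complex ^ 'n ^ 'n" where
  "cmat w = map_matrix of_int w"

definition z_lin :: "int ^ ('n::finite) \<Rightarrow> 'n cspace \<Rightarrow> complex" where
  "z_lin \<mu> p = pairing (cvec \<mu>) (fst p)"

definition l_lin :: "int ^ ('n::finite) \<Rightarrow> 'n cspace \<Rightarrow> complex" where
  "l_lin \<nu> p = pairing (snd p) (cvec \<nu>)"

text \<open>
  \<open>w\<close> acts on functions by \<open>a(z, \<lambda>) \<mapsto> a(w\<^sup>-\<^sup>1 z, \<lambda>)\<close>, where \<open>w\<^sup>-\<^sup>1\<close> is the transpose of \<open>w\<close> on the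
  cocharacter side, respectively by \<open>a(z, \<lambda>) \<mapsto> a(z, w\<^sup>-\<^sup>1 \<lambda>)\<close>. The lemmas \<open>act_z_mero_fun\<close> and
  \<open>act_d_mero_fun\<close> show that this does not depend on the representative.
\<close>

definition act_z :: "int ^ ('n::finite) ^ 'n \<Rightarrow> 'n mero \<Rightarrow> 'n mero" where
  "act_z w a = mero_fun (\<lambda>(z, l). rep_mero a (transpose (cmat w) *v z, l))"

definition act_d :: "int ^ ('n::finite) ^ 'n \<Rightarrow> 'n mero \<Rightarrow> 'n mero" where
  "act_d w a = mero_fun (\<lambda>(z, l). rep_mero a (z, cmat (matrix_inv w) *v l))"

definition clinear_equiv :: "(('n::finite) cspace \<Rightarrow> 'n cspace) \<Rightarrow> ('n cspace \<Rightarrow> 'n cspace) \<Rightarrow> bool" where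
  "clinear_equiv L M \<longleftrightarrow> bounded_linear L \<and> bounded_linear M \<and>
     (\<forall>c v. L (cscale c v) = cscale c (L v)) \<and> (\<forall>x. L (M x) = x) \<and> (\<forall>x. M (L x) = x)"

lemma clinear_equiv_open_vimage:
  assumes "clinear_equiv L M" "open S"
  shows "open (L -` S)" "open (M -` S)"
  using assms linear_continuous_on[of L UNIV] linear_continuous_on[of M UNIV]
  unfolding clinear_equiv_def by (auto intro: open_vimage)

lemma generic_eq_pullback:
  assumes e: "clinear_equiv L M" and "generic_eq f g"
  shows "generic_eq (\<lambda>x. f (L x)) (\<lambda>x. g (L x))"
proof -
  obtain S where S: "open S" "closure S = UNIV" "\<forall>x\<in>S. f x = g x"
    using assms(2) unfolding generic_eq_def by blast
  have "closure (L -` S) = UNIV"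
  proof (rule ccontr)
    assume "closure (L -` S) \<noteq> UNIV"
    then obtain p where p: "p \<in> - closure (L -` S)" by blast
    let ?V = "M -` (- closure (L -` S))"
    have "open ?V" by (intro clinear_equiv_open_vimage(2)[OF e] open_Compl closed_closure)
    moreover have "L p \<in> ?V" using p e by (simp add: clinear_equiv_def del: split_paired_All)
    ultimately have "?V \<inter> S \<noteq> {}" using open_Int_closure_eq_empty[of ?V S] S(2) by blast
    then obtain y where y: "M y \<notin> closure (L -` S)" "y \<in> S" by blast
    have "M y \<in> L -` S" using e y(2) by (simp add: clinear_equiv_def del: split_paired_All)
    hence "M y \<in> closure (L -` S)" using closure_subset[of "L -` S"] by (rule rev_subsetD)
    thus False using y(1) by contradiction
  qed
  thus ?thesis unfolding generic_eq_def using S clinear_equiv_open_vimage(1)[OF e S(1)]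
    by (intro exI[of _ "L -` S"]) auto
qed

lemma mholomorphic_on_pullback:
  assumes e: "clinear_equiv L M" and f: "mholomorphic_on f U"
  shows "mholomorphic_on (\<lambda>x. f (L x)) (L -` U)"
  unfolding mholomorphic_on_def
proof (intro ballI)
  fix p assume "p \<in> L -` U"
  then obtain D where D: "(f has_derivative D) (at (L p))" "\<forall>c v. D (cscale c v) = c * D v"
    using f unfolding mholomorphic_on_def by blast
  have "(L has_derivative L) (at p)"
    using e bounded_linear_imp_has_derivative unfolding clinear_equiv_def by blast
  from has_derivative_compose[OF this D(1)]
  show "\<exists>D. ((\<lambda>x. f (L x)) has_derivative D) (at p) \<and> (\<forall>c v. D (cscale c v) = c * D v)"
    using D(2) e unfolding clinear_equiv_def by (intro exI[of _ "\<lambda>v. D (L v)"] conjI)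
      (simp_all del: split_paired_All)
qed

lemma meromorphic_rep_pullback:
  assumes e: "clinear_equiv L M" and f: "meromorphic_rep f"
  shows "meromorphic_rep (\<lambda>x. f (L x))"
  unfolding meromorphic_rep_def
proof
  fix p
  obtain U g h where q: "L p \<in> U" "is_quotient_on f U g h"
    using f unfolding meromorphic_rep_def by blast
  have "is_quotient_on (\<lambda>x. f (L x)) (L -` U) (\<lambda>x. g (L x)) (\<lambda>x. h (L x))"
    unfolding is_quotient_on_def
  proof (intro conjI allI impI)
    fix V assume V: "open V" "V \<noteq> {}" "V \<subseteq> L -` U"
    have "open (M -` V)" using clinear_equiv_open_vimage(2)[OF e V(1)] .
    moreover have "M -` V \<noteq> {}" using V(2) e unfolding clinear_equiv_def
      by (metis all_not_in_conv vimage_eq)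
    moreover have "M -` V \<subseteq> U"
    proof
      fix y assume "y \<in> M -` V"
      hence "L (M y) \<in> U" using V(3) by blast
      thus "y \<in> U" using e by (simp add: clinear_equiv_def del: split_paired_All)
    qed
    ultimately obtain y where y: "M y \<in> V" "h y \<noteq> 0"
      using is_quotient_on_pt[OF q(2), of "M -` V"] by blast
    have "h (L (M y)) \<noteq> 0" using y(2) e unfolding clinear_equiv_def by metis
    thus "\<exists>x\<in>V. h (L x) \<noteq> 0" using y(1) by blast
  qed (use q(2) clinear_equiv_open_vimage(1)[OF e] mholomorphic_on_pullback[OF e]
       in \<open>auto simp: is_quotient_on_def\<close>)
  thus "\<exists>U g h. p \<in> U \<and> is_quotient_on (\<lambda>x. f (L x)) U g h" using q(1) by blast
qed

lemma mero_fun_pullback: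
  assumes e: "clinear_equiv L M" and f: "meromorphic_rep f"
  shows "mero_fun (\<lambda>x. rep_mero (mero_fun f) (L x)) = mero_fun (\<lambda>x. f (L x))"
  using generic_eq_pullback[OF e generic_eq_rep_mero[OF f]]
    mero_fun_eq_iff[OF meromorphic_rep_pullback[OF e rep_mero_meromorphic] meromorphic_rep_pullback[OF e f]]
  by blast

lemma cmat_mult: "cmat (A ** B) = cmat A ** cmat B"
  by (simp add: cmat_def matrix_matrix_mult_def vec_eq_iff)

lemma cmat_one: "cmat (mat 1) = mat 1"
  by (simp add: cmat_def mat_def vec_eq_iff)

lemma bounded_linear_matrix: "bounded_linear (\<lambda>x. (A :: complex ^ 'n ^ 'n::finite) *v x)"
  unfolding linear_conv_bounded_linear[symmetric]
  by (rule linearI)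
    (simp_all add: matrix_vector_mult_def vec_eq_iff ring_distribs sum.distrib scaleR_sum_right)

lemma clinear_equiv_matrices:
  fixes A A' B B' :: "complex ^ 'n ^ 'n::finite"
  assumes "A ** A' = mat 1" "A' ** A = mat 1" "B ** B' = mat 1" "B' ** B = mat 1"
  shows "clinear_equiv (\<lambda>p. (A *v fst p, B *v snd p)) (\<lambda>p. (A' *v fst p, B' *v snd p))"
proof -
  have bl: "bounded_linear (\<lambda>p. (A *v fst p, B *v snd p))" for A B :: "complex ^ 'n ^ 'n"
    by (intro bounded_linear_Pair bounded_linear_compose[OF bounded_linear_matrix]
        bounded_linear_fst bounded_linear_snd)
  have sc: "A *v (c *s x) = c *s (A *v x)" for A :: "complex ^ 'n ^ 'n" and c x
    by (simp add: matrix_vector_mult_def vec_eq_iff sum_distrib_left mult.left_commute)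
  show ?thesis unfolding clinear_equiv_def cscale_def
    using bl by (simp add: sc matrix_vector_mul_assoc assms)
qed

lemma matrix_inv_int:
  fixes w :: "int ^ 'n ^ 'n::finite"
  assumes "invertible w"
  shows "w ** matrix_inv w = mat 1" "matrix_inv w ** w = mat 1"
  using someI_ex[OF assms[unfolded invertible_def]] unfolding matrix_inv_def by auto

lemma act_z_mero_fun:
  assumes "invertible w" "meromorphic_rep f"
  shows "act_z w (mero_fun f) = mero_fun (\<lambda>(z, l). f (transpose (cmat w) *v z, l))"
proof -
  have "clinear_equiv (\<lambda>p. (transpose (cmat w) *v fst p, mat 1 *v snd p))
     (\<lambda>p. (transpose (cmat (matrix_inv w)) *v fst p, mat 1 *v snd p))"
    by (rule clinear_equiv_matrices)
      (simp_all add: matrix_transpose_mul[symmetric] cmat_mult[symmetric] matrix_inv_int[OF assms(1)]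
        cmat_one)
  from mero_fun_pullback[OF this assms(2)] show ?thesis
    by (simp add: act_z_def case_prod_unfold)
qed

lemma act_d_mero_fun:
  assumes "invertible w" "meromorphic_rep f"
  shows "act_d w (mero_fun f) = mero_fun (\<lambda>(z, l). f (z, cmat (matrix_inv w) *v l))"
proof -
  have "clinear_equiv (\<lambda>p. (mat 1 *v fst p, cmat (matrix_inv w) *v snd p))
     (\<lambda>p. (mat 1 *v fst p, cmat w *v snd p))"
    by (rule clinear_equiv_matrices)
      (simp_all add: cmat_mult[symmetric] matrix_inv_int[OF assms(1)] cmat_one)
  from mero_fun_pullback[OF this assms(2)] show ?thesis
    by (simp add: act_d_def case_prod_unfold)
qed


section \<open>The theta function\<close>

definition theta :: "complex \<Rightarrow> complex \<Rightarrow> complex" where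
  "theta \<tau> x = (let q = exp (2 * pi * \<i> * \<tau>) in
     1 / (2 * pi * \<i>) * (exp (pi * \<i> * x) - exp (- (pi * \<i> * x)))
     * (\<Prod>s. (1 - q ^ Suc s * exp (2 * pi * \<i> * x)) * (1 - q ^ Suc s * exp (- (2 * pi * \<i> * x))))
     * (\<Prod>s. inverse ((1 - q ^ Suc s)\<^sup>2)))"

lemma theta_holomorphic:
  assumes "Im \<tau> > 0" shows "theta \<tau> holomorphic_on UNIV"
proof -
  define q where "q = exp (2 * pi * \<i> * \<tau>)"
  have q1: "norm q < 1" using assms by (simp add: q_def norm_exp_eq_Re)
  define P where "P = (\<lambda>s x. (1 - q ^ Suc s * exp (2 * pi * \<i> * x)) * (1 - q ^ Suc s * exp (- (2 * pi * \<i> * x))))"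
  have bound: "norm (P s x - 1) \<le> norm q ^ s * (2 * exp (2 * pi * R) + 1)" if "norm x \<le> R" for s x R
  proof -
    have e: "norm (exp (2 * pi * \<i> * x)) \<le> exp (2 * pi * R)"
      "norm (exp (- (2 * pi * \<i> * x))) \<le> exp (2 * pi * R)"
      using that abs_Im_le_cmod[of x] mult_left_mono[of "Im x" R pi] mult_left_mono[of "- Im x" R pi]
      by (auto simp: norm_exp_eq_Re abs_le_iff mult.commute[of R])
    have "P s x - 1 = q ^ Suc s * q ^ Suc s - q ^ Suc s * (exp (2 * pi * \<i> * x) + exp (- (2 * pi * \<i> * x)))"
      by (simp add: P_def algebra_simps exp_minus_inverse)
    also have "norm \<dots> \<le> norm q ^ Suc s * norm q ^ Suc s
        + norm q ^ Suc s * (exp (2 * pi * R) + exp (2 * pi * R))"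
    proof (rule order.trans[OF norm_triangle_ineq4], intro add_mono)
      have "norm (exp (2 * pi * \<i> * x) + exp (- (2 * pi * \<i> * x))) \<le> exp (2 * pi * R) + exp (2 * pi * R)"
        using norm_triangle_le[OF add_mono[OF e]] .
      thus "norm (q ^ Suc s * (exp (2 * pi * \<i> * x) + exp (- (2 * pi * \<i> * x))))
          \<le> norm q ^ Suc s * (exp (2 * pi * R) + exp (2 * pi * R))"
        unfolding norm_mult norm_power by (rule mult_left_mono) simp
    qed (simp add: norm_mult norm_power)
    also have "\<dots> \<le> norm q ^ s * 1 + norm q ^ s * (exp (2 * pi * R) + exp (2 * pi * R))"
      using q1 by (intro add_mono mult_mono power_decreasing power_le_one) auto
    finally show ?thesis by (simp add: algebra_simps)
  qed
  have sm: "summable (\<lambda>s. norm q ^ s * C)" for C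
    using q1 by (intro summable_mult2 summable_geometric) auto
  have conv: "convergent_prod (\<lambda>s. P s x)" for x
  proof (rule abs_convergent_prod_imp_convergent_prod)
    show "abs_convergent_prod (\<lambda>s. P s x)" unfolding abs_convergent_prod_conv_summable
      by (rule summable_comparison_test'[OF sm, of 0]) (use bound[of x "norm x"] in auto)
  qed
  have ul: "uniform_limit (cball 0 R) (\<lambda>n x. \<Prod>s<n. P s x) (\<lambda>x. \<Prod>s. P s x) sequentially" for R
  proof -
    have "uniformly_convergent_on (cball 0 R) (\<lambda>n x. \<Prod>s<n. P s x)"
    proof (rule uniformly_convergent_on_prod')
      show "uniformly_convergent_on (cball 0 R) (\<lambda>n x. \<Sum>s<n. norm (P s x - 1))"
        by (rule Weierstrass_m_test'[OF _ sm]) (use bound in auto)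
    qed (auto simp: P_def intro!: continuous_intros)
    then obtain g where g: "uniform_limit (cball 0 R) (\<lambda>n x. \<Prod>s<n. P s x) g sequentially"
      by (auto simp: uniformly_convergent_on_def)
    have "g x = (\<Prod>s. P s x)" if "x \<in> cball 0 R" for x
    proof (rule LIMSEQ_unique)
      show "(\<lambda>n. \<Prod>s<n. P s x) \<longlonglongrightarrow> g x" using tendsto_uniform_limitI[OF g that] .
      show "(\<lambda>n. \<Prod>s<n. P s x) \<longlonglongrightarrow> (\<Prod>s. P s x)"
        using convergent_prod_LIMSEQ[OF conv[of x]] by (simp add: LIMSEQ_lessThan_iff_atMost)
    qed
    with g show ?thesis by (subst uniform_limit_cong') auto
  qed
  have "(\<lambda>x. \<Prod>s. P s x) holomorphic_on UNIV"
  proof (rule holomorphic_uniform_sequence)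
    fix z :: complex
    have "uniform_limit (cball z 1) (\<lambda>n x. \<Prod>s<n. P s x) (\<lambda>x. \<Prod>s. P s x) sequentially"
      by (rule uniform_limit_on_subset[OF ul[of "norm z + 1"]]) (simp add: cball_subset_cball_iff)
    thus "\<exists>d>0. cball z d \<subseteq> UNIV \<and>
        uniform_limit (cball z d) (\<lambda>n x. \<Prod>s<n. P s x) (\<lambda>x. \<Prod>s. P s x) sequentially"
      by (intro exI[of _ 1]) auto
  qed (auto simp: P_def intro!: holomorphic_intros)
  thus ?thesis unfolding theta_def Let_def q_def[symmetric] P_def
    by (auto intro!: holomorphic_intros)
qed

definition theta_mero :: "complex \<Rightarrow> (('n::finite) cspace \<Rightarrow> complex) \<Rightarrow> 'n mero" where
  "theta_mero \<tau> u = mero_fun (\<lambda>p. theta \<tau> (u p))"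

lemma theta_meromorphic:
  "Im \<tau> > 0 \<Longrightarrow> mholomorphic_on u UNIV \<Longrightarrow> meromorphic_rep (\<lambda>p. theta \<tau> (u p))"
  using meromorphic_rep_holomorphic[OF mholomorphic_on_compose[OF theta_holomorphic]] by blast

lemma mholomorphic_on_linear:
  assumes "bounded_linear f" "\<And>c v. f (cscale c v) = c * f v"
  shows "mholomorphic_on f U"
  unfolding mholomorphic_on_def
  using assms bounded_linear_imp_has_derivative by blast

lemma mholomorphic_on_z_lin: "mholomorphic_on (z_lin \<mu>) U"
proof (rule mholomorphic_on_linear)
  show "bounded_linear (z_lin \<mu>)" unfolding linear_conv_bounded_linear[symmetric]
    by (rule linearI)
      (simp_all add: z_lin_def pairing_def ring_distribs sum.distrib scaleR_sum_right)
  show "z_lin \<mu> (cscale c v) = c * z_lin \<mu> v" for c v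
    by (simp add: z_lin_def pairing_def cscale_def sum_distrib_left mult.left_commute)
qed

lemma mholomorphic_on_l_lin: "mholomorphic_on (l_lin \<nu>) U"
proof (rule mholomorphic_on_linear)
  show "bounded_linear (l_lin \<nu>)" unfolding linear_conv_bounded_linear[symmetric]
    by (rule linearI)
      (simp_all add: l_lin_def pairing_def ring_distribs sum.distrib scaleR_sum_right)
  show "l_lin \<nu> (cscale c v) = c * l_lin \<nu> v" for c v
    by (simp add: l_lin_def pairing_def cscale_def sum_distrib_left mult.assoc)
qed


section \<open>The twisted group algebras\<close>

text \<open>
  An element of the first algebra is the family of its coefficients at the basis \<open>\<delta>\<^sup>d\<^sub>w\<close>; an element of
  the second is the family of its coefficients, in the first algebra, at the basis \<open>\<delta>\<^sub>v\<close>. Thus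
  \<open>F v w\<close> is the coefficient of \<open>\<delta>\<^sup>d\<^sub>w \<delta>\<^sub>v\<close>. Addition and zero are the pointwise ones, but the
  pointwise product of functions is not the product of these algebras.
\<close>

type_synonym 'n twisted = "int ^ 'n ^ 'n \<Rightarrow> 'n mero"
type_synonym 'n bitwisted = "int ^ 'n ^ 'n \<Rightarrow> 'n twisted"

definition QWd :: "('n::finite) root_datum \<Rightarrow> 'n twisted set" where
  "QWd D = {c. \<forall>w. w \<notin> weyl_group D \<longrightarrow> c w = 0}"

definition QWdW :: "('n::finite) root_datum \<Rightarrow> 'n bitwisted set" where
  "QWdW D = {F. (\<forall>v\<in>weyl_group D. F v \<in> QWd D) \<and> (\<forall>v. v \<notin> weyl_group D \<longrightarrow> F v = 0)}"

definition factorizations :: "('n::finite) root_datum \<Rightarrow> int ^ 'n ^ 'n \<Rightarrow> ((int ^ 'n ^ 'n) \<times> (int ^ 'n ^ 'n)) set" where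
  "factorizations D x = {(w, w'). w \<in> weyl_group D \<and> w' \<in> weyl_group D \<and> w ** w' = x}"

definition QWd_mult :: "('n::finite) root_datum \<Rightarrow> 'n twisted \<Rightarrow> 'n twisted \<Rightarrow> 'n twisted" where
  "QWd_mult D c c' = (\<lambda>x. \<Sum>(w, w')\<in>factorizations D x. c w * act_d w (c' w'))"

definition QWdW_mult :: "('n::finite) root_datum \<Rightarrow> 'n bitwisted \<Rightarrow> 'n bitwisted \<Rightarrow> 'n bitwisted" where
  "QWdW_mult D F G = (\<lambda>y x. \<Sum>(v, v')\<in>factorizations D y. \<Sum>(w, w')\<in>factorizations D x.
     F v w * act_z v (act_d w (G v' w')))"

definition QWd_smult :: "('n::finite) root_datum \<Rightarrow> 'n twisted \<Rightarrow> 'n bitwisted \<Rightarrow> 'n bitwisted" where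
  "QWd_smult D c F = (\<lambda>v. QWd_mult D c (F v))"

definition Q_smult :: "('n::finite) mero \<Rightarrow> 'n bitwisted \<Rightarrow> 'n bitwisted" where
  "Q_smult a F = (\<lambda>v w. a * F v w)"

definition delta :: "int ^ ('n::finite) ^ 'n \<Rightarrow> 'n bitwisted" where
  "delta v = (\<lambda>v' w'. if v' = v \<and> w' = mat 1 then 1 else 0)"

definition delta_d :: "int ^ ('n::finite) ^ 'n \<Rightarrow> 'n bitwisted" where
  "delta_d w = (\<lambda>v' w'. if v' = mat 1 \<and> w' = w then 1 else 0)"

definition left_basis :: "('n::finite) root_datum \<Rightarrow> 'n bitwisted set \<Rightarrow> bool" where
  "left_basis D B \<longleftrightarrow>
     B \<subseteq> QWdW D \<and>
     (\<forall>F\<in>QWdW D. \<exists>S c. finite S \<and> S \<subseteq> B \<and> (\<forall>x\<in>S. c x \<in> QWd D) \<and> F = (\<Sum>x\<in>S. QWd_smult D (c x) x)) \<and>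
     (\<forall>S c. finite S \<longrightarrow> S \<subseteq> B \<longrightarrow> (\<forall>x\<in>S. c x \<in> QWd D) \<longrightarrow>
        (\<Sum>x\<in>S. QWd_smult D (c x) x) = 0 \<longrightarrow> (\<forall>x\<in>S. c x = 0))"


section \<open>Elliptic Demazure--Lusztig operators\<close>

definition T_simple :: "complex \<Rightarrow> complex \<Rightarrow> ('n::finite) root_datum \<Rightarrow> int ^ 'n \<Rightarrow> 'n bitwisted" where
  "T_simple \<tau> h D \<alpha> =
     (let z = z_lin \<alpha>; l = l_lin (coroot D \<alpha>); s = reflection D \<alpha> in
       Q_smult (theta_mero \<tau> (\<lambda>p. h - z p) * theta_mero \<tau> l
                 / (theta_mero \<tau> z * theta_mero \<tau> (\<lambda>p. h - l p)))
               (QWdW_mult D (delta s) (delta_d s))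
       + Q_smult (theta_mero \<tau> (\<lambda>_. h) * theta_mero \<tau> (\<lambda>p. z p - l p)
                 / (theta_mero \<tau> z * theta_mero \<tau> (\<lambda>p. h - l p)))
               (delta_d s))"

definition T_word :: "complex \<Rightarrow> complex \<Rightarrow> ('n::finite) root_datum \<Rightarrow> (int ^ 'n) list \<Rightarrow> 'n bitwisted" where
  "T_word \<tau> h D \<alpha>s = foldr (\<lambda>\<alpha> x. QWdW_mult D (T_simple \<tau> h D \<alpha>) x) \<alpha>s (delta (mat 1))"

end

theory Submission
  imports Defs
begin

text \<open>
  Multiplying out a reduced word of \<open>w\<close> shows that \<open>T\<^sub>w\<close> is \<open>\<delta>\<^sup>d\<^sub>w\<close> times a combination of the
  \<open>\<delta>\<^sub>v\<close>, where \<open>v\<close> runs through products of subwords, hence \<open>v \<le> w\<close>. Only the full word gives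
  \<open>v = w\<close>, and its coefficient is the product over the inversions of \<open>w\<close>. Undoing the dynamical part,
  the elements \<open>\<delta>\<^sup>d\<close> at \<open>w\<^sup>-\<^sup>1\<close> times \<open>T\<^sub>w\<close> are related to the \<open>\<delta>\<^sub>v\<close> by a matrix over the field
  of meromorphic functions that is triangular for the Bruhat order and has nonzero diagonal. Its inverse
  provides the coefficients \<open>b\<close> and the basis property.
\<close>

section \<open>Integer matrices and reflections\<close>

text \<open>The dynamical action twists both orthogonality relations. Writing a_{w,v} as the image
  under w^d of an entry A_{w,v} removes the twist: the first relation becomes w^d applied to A b =
  1, the second is literally b A = 1, and one inversion over a commutative field yields both. The
  product formula on the diagonal rests on \<delta>_s \<delta>^d_s carrying the factor of a root
  \<beta> to that of s \<beta>. This needs the coroot of s \<beta> to be s applied to the coroot of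
  \<beta>, whereas the root datum only says that reflections permute the coroots. Finiteness of the
  Weyl group also takes an argument, because the roots need not span the character lattice.\<close>

lemma matrix_vector_ext:
  fixes A B :: "int ^ 'n ^ 'n::finite"
  assumes "\<And>x. A *v x = B *v x"
  shows "A = B"
proof -
  have "A $ i $ j = B $ i $ j" for i j
  proof -
    have "(M *v axis j 1) $ i = M $ i $ j" for M :: "int ^ 'n ^ 'n"
      by (simp add: matrix_vector_mult_def axis_def if_distrib[of "(*) _"] cong: if_cong)
    then show ?thesis using assms[of "axis j 1"] by metis
  qed
  then show ?thesis by (simp add: vec_eq_iff)
qed

lemma matrix_inv_unique:
  fixes A B :: "int ^ 'n ^ 'n::finite"
  assumes "A ** B = mat 1" "B ** A = mat 1"
  shows "matrix_inv A = B"
proof -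
  have "invertible A" using assms unfolding invertible_def by blast
  then have "matrix_inv A = matrix_inv A ** (A ** B)" using assms by simp
  also have "\<dots> = B" using matrix_inv_int[OF \<open>invertible A\<close>] by (simp add: matrix_mul_assoc)
  finally show ?thesis .
qed

lemma pairing_diff_left: "pairing (x - y) z = pairing x z - pairing y z"
  by (simp add: pairing_def left_diff_distrib sum_subtractf)

lemma pairing_add_right: "pairing x (y + z) = pairing x y + pairing x z"
  by (simp add: pairing_def distrib_left sum.distrib)

lemma pairing_diff_right: "pairing x (y - z) = pairing x y - pairing x z"
  by (simp add: pairing_def right_diff_distrib sum_subtractf)

lemma pairing_scale_left: "pairing (c *s x) z = c * pairing x z"
  by (simp add: pairing_def sum_distrib_left mult.assoc)

lemma pairing_scale_right: "pairing x (c *s z) = c * pairing x z"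
  by (simp add: pairing_def sum_distrib_left mult.left_commute)

lemma pairing_zero_left [simp]: "pairing 0 z = 0"
  by (simp add: pairing_def)

lemma pairing_minus_left: "pairing (- x) z = - pairing x z"
  by (simp add: pairing_def sum_negf)

lemma pairing_matrix_left: "pairing (A *v x) y = pairing x (transpose A *v y)"
proof -
  have "pairing (A *v x) y = (\<Sum>i\<in>UNIV. (\<Sum>j\<in>UNIV. A $ i $ j * x $ j * y $ i))"
    by (simp add: pairing_def matrix_vector_mult_def sum_distrib_right)
  also have "\<dots> = (\<Sum>j\<in>UNIV. (\<Sum>i\<in>UNIV. A $ i $ j * x $ j * y $ i))"
    by (rule sum.swap)
  also have "\<dots> = pairing x (transpose A *v y)"
    by (simp add: pairing_def matrix_vector_mult_def transpose_def sum_distrib_left mult_ac)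
  finally show ?thesis .
qed

lemmas pairing_simps = pairing_diff_left pairing_diff_right pairing_scale_left pairing_scale_right
  pairing_minus_left

lemma matrix_vector_scale:
  fixes A :: "'a::comm_ring_1 ^ 'n ^ 'm::finite"
  shows "A *v (c *s x) = c *s (A *v x)"
  by (simp add: matrix_vector_mult_def vec_eq_iff sum_distrib_left mult.left_commute)

lemma matrix_vector_diff:
  fixes A :: "'a::comm_ring_1 ^ 'n ^ 'm::finite"
  shows "A *v (x - y) = A *v x - A *v y"
  by (simp add: matrix_vector_mult_def vec_eq_iff right_diff_distrib sum_subtractf)

lemma matrix_vector_minus:
  fixes A :: "'a::comm_ring_1 ^ 'n ^ 'm::finite"
  shows "A *v (- x) = - (A *v x)"
  by (simp add: matrix_vector_mult_def vec_eq_iff sum_negf)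

lemma reflection_apply: "reflection D \<alpha> *v x = x - pairing x (coroot D \<alpha>) *s \<alpha>"
proof -
  have "(reflection D \<alpha> *v x) $ i = (x - pairing x (coroot D \<alpha>) *s \<alpha>) $ i" for i
  proof -
    have "(reflection D \<alpha> *v x) $ i =
        (\<Sum>j\<in>UNIV. (if i = j then x $ j else 0) - x $ j * coroot D \<alpha> $ j * \<alpha> $ i)"
      unfolding reflection_def matrix_vector_mult_def by (auto simp: mat_def intro!: sum.cong)
        (simp_all add: algebra_simps)
    then show ?thesis by (simp add: sum_subtractf pairing_def sum_distrib_right)
  qed
  then show ?thesis by (simp add: vec_eq_iff)
qed

lemma transpose_reflection_apply:
  "transpose (reflection D \<alpha>) *v y = y - pairing \<alpha> y *s coroot D \<alpha>"
proof -
  have "(transpose (reflection D \<alpha>) *v y) $ i = (y - pairing \<alpha> y *s coroot D \<alpha>) $ i" for i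
  proof -
    have "(transpose (reflection D \<alpha>) *v y) $ i =
        (\<Sum>j\<in>UNIV. (if i = j then y $ j else 0) - \<alpha> $ j * y $ j * coroot D \<alpha> $ i)"
      unfolding reflection_def matrix_vector_mult_def
      by (auto simp: mat_def transpose_def intro!: sum.cong) (simp_all add: algebra_simps)
    then show ?thesis by (simp add: sum_subtractf pairing_def sum_distrib_right)
  qed
  then show ?thesis by (simp add: vec_eq_iff)
qed

declare transpose_matrix_vector [simp del]

lemma weyl_group_mult:
  "v \<in> weyl_group D \<Longrightarrow> w \<in> weyl_group D \<Longrightarrow> v ** w \<in> weyl_group D"
  by (induction rule: weyl_group.induct)
    (simp_all add: matrix_mul_assoc[symmetric] weyl_group.step)

lemma word_prod_Nil [simp]: "word_prod D [] = mat 1"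
  by (simp add: word_prod_def)

lemma word_prod_Cons [simp]: "word_prod D (\<alpha> # \<alpha>s) = reflection D \<alpha> ** word_prod D \<alpha>s"
  by (simp add: word_prod_def)

lemma weyl_length_le:
  "set \<alpha>s \<subseteq> simple_roots D \<Longrightarrow> weyl_length D (word_prod D \<alpha>s) \<le> length \<alpha>s"
  unfolding weyl_length_def by (rule Least_le) blast

section \<open>Root system and Bruhat order\<close>

text \<open>
  That simple reflections generate the Weyl group is an assumption here, because the theorem supplies
  reduced words for all elements.
\<close>

locale simply_generated_root_datum =
  fixes D :: "('n::finite) root_datum"
  assumes datum: "based_root_datum D"
    and simple_generation: "w \<in> weyl_group D \<Longrightarrow> \<exists>\<alpha>s. reduced_word D \<alpha>s w"
begin

abbreviation "W \<equiv> weyl_group D"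
abbreviation "len \<equiv> weyl_length D"
abbreviation "s \<equiv> reflection D"

lemma finite_roots: "finite (roots D)"
  and pairing_coroot: "\<alpha> \<in> roots D \<Longrightarrow> pairing \<alpha> (coroot D \<alpha>) = 2"
  and reflection_root: "\<alpha> \<in> roots D \<Longrightarrow> \<beta> \<in> roots D \<Longrightarrow> s \<alpha> *v \<beta> \<in> roots D"
  and reflection_coroot: "\<alpha> \<in> roots D \<Longrightarrow> y \<in> coroot D ` roots D \<Longrightarrow>
    transpose (s \<alpha>) *v y \<in> coroot D ` roots D"
  and double_not_root: "\<alpha> \<in> roots D \<Longrightarrow> 2 *s \<alpha> \<notin> roots D"
  and simple_subset: "simple_roots D \<subseteq> roots D"
  and simple_independent:
    "(\<Sum>\<alpha>\<in>simple_roots D. c \<alpha> *s \<alpha>) = 0 \<Longrightarrow> \<alpha> \<in> simple_roots D \<Longrightarrow> c \<alpha> = (0::int)"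
  and pos_or_neg: "\<beta> \<in> roots D \<Longrightarrow> \<beta> \<in> pos_roots D \<or> - \<beta> \<in> pos_roots D"
  using datum unfolding based_root_datum_def by auto

lemma simple_root: "\<alpha> \<in> simple_roots D \<Longrightarrow> \<alpha> \<in> roots D"
  using simple_subset by blast

lemma finite_simple: "finite (simple_roots D)"
  using simple_subset finite_roots finite_subset by blast

lemma pos_root: "\<beta> \<in> pos_roots D \<Longrightarrow> \<beta> \<in> roots D"
  by (simp add: pos_roots_def)

lemma reflection_self: "\<alpha> \<in> roots D \<Longrightarrow> s \<alpha> *v \<alpha> = - \<alpha>"
  by (simp add: reflection_apply pairing_coroot vec_eq_iff)

lemma reflection_involution: "\<alpha> \<in> roots D \<Longrightarrow> s \<alpha> ** s \<alpha> = mat 1"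
  by (rule matrix_vector_ext)
    (simp add: matrix_vector_mul_assoc[symmetric] reflection_apply pairing_simps pairing_coroot
      vec_eq_iff)

lemma reflection_involution': "\<alpha> \<in> roots D \<Longrightarrow> s \<alpha> ** (s \<alpha> ** w) = w"
  by (simp add: matrix_mul_assoc reflection_involution)

lemma reflection_involution_apply: "\<alpha> \<in> roots D \<Longrightarrow> s \<alpha> *v (s \<alpha> *v x) = x"
  by (simp add: matrix_vector_mul_assoc reflection_involution)

lemma root_nonzero: "\<alpha> \<in> roots D \<Longrightarrow> \<alpha> \<noteq> 0"
  using pairing_coroot by force

text \<open>
  With \<open>\<gamma> = s\<^sub>\<alpha> \<beta>\<close> and \<open>\<nu> = s\<^sub>\<alpha> \<beta>\<^sup>\<or>\<close>, the product of the two reflections \<open>y \<mapsto> y - \<langle>\<gamma>, y\<rangle> \<gamma>\<^sup>\<or>\<close> and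
  \<open>y \<mapsto> y - \<langle>\<gamma>, y\<rangle> \<nu>\<close> is the transvection \<open>y \<mapsto> y + \<langle>\<gamma>, y\<rangle> (\<nu> - \<gamma>\<^sup>\<or>)\<close>. It permutes the finite set of
  coroots, so \<open>\<gamma>\<^sup>\<or>\<close> has a finite orbit, which forces \<open>\<nu> = \<gamma>\<^sup>\<or>\<close>.
\<close>

lemma coroot_reflection:
  assumes \<alpha>: "\<alpha> \<in> roots D" and \<beta>: "\<beta> \<in> roots D"
  shows "coroot D (s \<alpha> *v \<beta>) = transpose (s \<alpha>) *v coroot D \<beta>"
proof (rule ccontr)
  define \<gamma> \<nu> where "\<gamma> = s \<alpha> *v \<beta>" and "\<nu> = transpose (s \<alpha>) *v coroot D \<beta>"
  define \<epsilon> where "\<epsilon> = \<nu> - coroot D \<gamma>"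
  assume "coroot D (s \<alpha> *v \<beta>) \<noteq> transpose (s \<alpha>) *v coroot D \<beta>"
  then have ne: "\<epsilon> \<noteq> 0" by (simp add: \<epsilon>_def \<gamma>_def \<nu>_def)
  have \<gamma>: "\<gamma> \<in> roots D" unfolding \<gamma>_def using assms by (rule reflection_root)
  have tt: "transpose (s \<alpha>) *v (transpose (s \<alpha>) *v y) = y" for y
  proof -
    have "transpose (s \<alpha>) ** transpose (s \<alpha>) = mat 1"
      by (simp add: matrix_transpose_mul[symmetric] reflection_involution[OF \<alpha>] transpose_mat)
    then show ?thesis by (metis matrix_vector_mul_assoc matrix_vector_mul_lid)
  qed
  have \<gamma>\<nu>: "pairing \<gamma> \<nu> = 2"
    unfolding \<gamma>_def \<nu>_def by (simp add: pairing_matrix_left tt pairing_coroot[OF \<beta>])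
  have \<gamma>\<epsilon>: "pairing \<gamma> \<epsilon> = 0"
    by (simp add: \<epsilon>_def pairing_diff_right \<gamma>\<nu> pairing_coroot[OF \<gamma>])
  have r: "transpose (s \<alpha>) *v (transpose (s \<beta>) *v (transpose (s \<alpha>) *v y)) = y - pairing \<gamma> y *s \<nu>" for y
    unfolding transpose_reflection_apply[of D \<beta>]
    by (simp add: matrix_vector_diff matrix_vector_scale tt \<nu>_def \<gamma>_def pairing_matrix_left)
  have step: "y + pairing \<gamma> y *s \<epsilon> \<in> coroot D ` roots D" if "y \<in> coroot D ` roots D" for y
  proof -
    have "transpose (s \<alpha>) *v (transpose (s \<beta>) *v (transpose (s \<alpha>) *v (transpose (s \<gamma>) *v y)))
        \<in> coroot D ` roots D"
      using that \<alpha> \<beta> \<gamma> by (intro reflection_coroot)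
    also have "transpose (s \<alpha>) *v (transpose (s \<beta>) *v (transpose (s \<alpha>) *v (transpose (s \<gamma>) *v y)))
        = y + pairing \<gamma> y *s \<epsilon>"
      unfolding r transpose_reflection_apply[of D \<gamma>]
      by (simp add: pairing_simps pairing_coroot[OF \<gamma>] \<epsilon>_def vec_eq_iff algebra_simps)
    finally show ?thesis .
  qed
  \<comment> \<open>Each application of the transvection adds <\<gamma>, y> \<epsilon>, and
    <\<gamma>, y> stays equal to 2 along the orbit because <\<gamma>, \<epsilon>> = 0; hence the
    even multiples of \<epsilon>.\<close>
  have orbit: "coroot D \<gamma> + (2 * int k) *s \<epsilon> \<in> coroot D ` roots D" for k
  proof (induction k)
    case 0
    then show ?case using \<gamma> by simp
  next
    case (Suc k)
    have p: "pairing \<gamma> (coroot D \<gamma> + (2 * int k) *s \<epsilon>) = 2"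
      unfolding pairing_add_right pairing_scale_right by (simp add: pairing_coroot[OF \<gamma>] \<gamma>\<epsilon>)
    have "coroot D \<gamma> + (2 * int k) *s \<epsilon> + 2 *s \<epsilon> = coroot D \<gamma> + (2 * int (Suc k)) *s \<epsilon>"
      by (simp add: vec_eq_iff algebra_simps)
    then show ?case using step[OF Suc.IH] unfolding p by (simp only:)
  qed
  obtain i where "\<epsilon> $ i \<noteq> 0" using ne by (auto simp: vec_eq_iff)
  then have "inj (\<lambda>k. (coroot D \<gamma> + (2 * int k) *s \<epsilon>) $ i)"
    by (intro injI) simp
  then have "inj (\<lambda>k. coroot D \<gamma> + (2 * int k) *s \<epsilon>)"
    unfolding inj_def by metis
  moreover have "range (\<lambda>k. coroot D \<gamma> + (2 * int k) *s \<epsilon>) \<subseteq> coroot D ` roots D"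
    using orbit by (rule image_subsetI)
  ultimately have "finite (UNIV :: nat set)"
    using finite_subset[OF _ finite_imageI[OF finite_roots]] finite_imageD by metis
  then show False by simp
qed

section \<open>Inverses in the Weyl group, its action on roots, conjugation of reflections\<close>

lemma weyl_invertible:
  "w \<in> W \<Longrightarrow> \<exists>u\<in>W. w ** u = mat 1 \<and> u ** w = mat 1"
proof (induction rule: weyl_group.induct)
  case one
  then show ?case by (intro bexI[of _ "mat 1"]) (auto intro: weyl_group.one)
next
  case (step \<alpha> w)
  then obtain u where u: "u \<in> W" "w ** u = mat 1" "u ** w = mat 1" by blast
  have "s \<alpha> \<in> W" using weyl_group.step[OF step(1) weyl_group.one] by simp
  then have "u ** s \<alpha> \<in> W" using u weyl_group_mult by blast
  moreover have "s \<alpha> ** w ** (u ** s \<alpha>) = s \<alpha> ** (w ** u) ** s \<alpha>"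
    "u ** s \<alpha> ** (s \<alpha> ** w) = u ** (s \<alpha> ** s \<alpha>) ** w"
    by (simp_all add: matrix_mul_assoc)
  ultimately show ?case using u step(1) by (intro bexI[of _ "u ** s \<alpha>"]) (simp_all add: reflection_involution)
qed

lemma reflection_weyl: "\<alpha> \<in> roots D \<Longrightarrow> s \<alpha> \<in> W"
  using weyl_group.step[OF _ weyl_group.one] by simp

lemma weyl_inv: "w \<in> W \<Longrightarrow> matrix_inv w \<in> W"
  and weyl_inv_right: "w \<in> W \<Longrightarrow> w ** matrix_inv w = mat 1"
  and weyl_inv_left: "w \<in> W \<Longrightarrow> matrix_inv w ** w = mat 1"
  and weyl_inv_inv: "w \<in> W \<Longrightarrow> matrix_inv (matrix_inv w) = w"
  and weyl_is_invertible: "w \<in> W \<Longrightarrow> invertible w"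
proof -
  have "matrix_inv w \<in> W \<and> w ** matrix_inv w = mat 1 \<and> matrix_inv w ** w = mat 1 \<and>
    matrix_inv (matrix_inv w) = w \<and> invertible w" if "w \<in> W"
  proof -
    obtain u where u: "u \<in> W" "w ** u = mat 1" "u ** w = mat 1" using weyl_invertible \<open>w \<in> W\<close> by blast
    then have "invertible w" unfolding invertible_def by blast
    with u show ?thesis using matrix_inv_unique[OF u(2,3)] matrix_inv_unique[OF u(3,2)] by simp
  qed
  then show "w \<in> W \<Longrightarrow> matrix_inv w \<in> W" "w \<in> W \<Longrightarrow> w ** matrix_inv w = mat 1"
    "w \<in> W \<Longrightarrow> matrix_inv w ** w = mat 1" "w \<in> W \<Longrightarrow> matrix_inv (matrix_inv w) = w"
    "w \<in> W \<Longrightarrow> invertible w" by blast+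
qed

lemma weyl_inv_right': "w \<in> W \<Longrightarrow> w ** (matrix_inv w ** x) = x"
  and weyl_inv_left': "w \<in> W \<Longrightarrow> matrix_inv w ** (w ** x) = x"
  by (simp_all add: matrix_mul_assoc weyl_inv_right weyl_inv_left)

lemma weyl_inv_mult: "v \<in> W \<Longrightarrow> w \<in> W \<Longrightarrow> matrix_inv (v ** w) = matrix_inv w ** matrix_inv v"
  by (rule matrix_inv_unique)
    (simp_all add: matrix_mul_assoc[symmetric] weyl_inv_right' weyl_inv_left' weyl_inv_right weyl_inv_left)

lemma reflection_inv: "\<alpha> \<in> roots D \<Longrightarrow> matrix_inv (s \<alpha>) = s \<alpha>"
  by (rule matrix_inv_unique) (simp_all add: reflection_involution)

lemma inv_reflection_mult_apply:
  assumes "w \<in> W" "\<alpha> \<in> roots D"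
  shows "matrix_inv (s \<alpha> ** w) *v \<beta> = matrix_inv w *v (s \<alpha> *v \<beta>)"
  unfolding weyl_inv_mult[OF reflection_weyl[OF assms(2)] assms(1)] reflection_inv[OF assms(2)]
  by (rule matrix_vector_mul_assoc[symmetric])

lemma weyl_root: "w \<in> W \<Longrightarrow> \<beta> \<in> roots D \<Longrightarrow> w *v \<beta> \<in> roots D"
  by (induction rule: weyl_group.induct)
    (simp_all add: matrix_vector_mul_assoc[symmetric] reflection_root)

text \<open>The conjugate sends x to x minus the pairing of x with s_\<alpha> applied to the coroot
  of \<beta>, times s_\<alpha> \<beta>; \<open>coroot_reflection\<close> identifies that covector as
  the coroot of s_\<alpha> \<beta>.\<close>

lemma reflection_conj:
  assumes "\<alpha> \<in> roots D" "\<beta> \<in> roots D"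
  shows "s (s \<alpha> *v \<beta>) = s \<alpha> ** s \<beta> ** s \<alpha>"
  by (rule matrix_vector_ext)
    (simp add: matrix_vector_mul_assoc[symmetric] reflection_apply[of D "s \<alpha> *v \<beta>"]
      reflection_apply[of D \<beta>] coroot_reflection[OF assms] pairing_matrix_left matrix_vector_diff
      matrix_vector_scale reflection_involution_apply assms)

text \<open>Since -\<alpha> = s_\<alpha> \<alpha>, this is the conjugation of s_\<alpha> by itself.
  It allows the root of a Bruhat step to be taken positive.\<close>

lemma reflection_uminus: "\<alpha> \<in> roots D \<Longrightarrow> s (- \<alpha>) = s \<alpha>"
  using reflection_conj[of \<alpha> \<alpha>] by (simp add: reflection_self reflection_involution)

section \<open>Positive roots, the exchange property and the length function\<close>

lemma pos_not_neg:
  assumes "\<beta> \<in> pos_roots D"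
  shows "- \<beta> \<notin> pos_roots D"
proof
  assume "- \<beta> \<in> pos_roots D"
  with assms obtain c d :: "int ^ 'n \<Rightarrow> nat" where
    c: "\<beta> = (\<Sum>\<alpha>\<in>simple_roots D. int (c \<alpha>) *s \<alpha>)" and d: "- \<beta> = (\<Sum>\<alpha>\<in>simple_roots D. int (d \<alpha>) *s \<alpha>)"
    unfolding pos_roots_def by blast
  have "(\<Sum>\<alpha>\<in>simple_roots D. (int (c \<alpha>) + int (d \<alpha>)) *s \<alpha>) = \<beta> + - \<beta>"
    unfolding c[symmetric] d[symmetric] by (subst c, subst d) (simp add: vector_sadd_rdistrib sum.distrib)
  then have "\<forall>\<alpha>\<in>simple_roots D. int (c \<alpha>) + int (d \<alpha>) = 0"
    using simple_independent[of "\<lambda>\<alpha>. int (c \<alpha>) + int (d \<alpha>)"] by simp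
  then have "\<forall>\<alpha>\<in>simple_roots D. int (c \<alpha>) *s \<alpha> = 0" by auto
  then have "\<beta> = 0" unfolding c by (intro sum.neutral)
  then show False using root_nonzero[OF pos_root[OF assms]] by simp
qed

lemma simple_pos: "\<alpha> \<in> simple_roots D \<Longrightarrow> \<alpha> \<in> pos_roots D"
proof -
  assume \<alpha>: "\<alpha> \<in> simple_roots D"
  have "(\<Sum>\<gamma>\<in>simple_roots D. int (if \<gamma> = \<alpha> then 1 else 0) *s \<gamma>) = (\<Sum>\<gamma>\<in>simple_roots D. if \<gamma> = \<alpha> then \<gamma> else 0)"
    by (intro sum.cong) auto
  also have "\<dots> = \<alpha>" using \<alpha> finite_simple by simp
  finally show ?thesis unfolding pos_roots_def using simple_root[OF \<alpha>]
    by (auto intro!: exI[of _ "\<lambda>\<gamma>. if \<gamma> = \<alpha> then 1 else 0"])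
qed

text \<open>A simple reflection changes only the coordinate at \<alpha>. If \<beta> became negative,
  all its other coordinates would vanish, so \<beta> would be a multiple of \<alpha>, and a reduced
  root system leaves only \<alpha> itself.\<close>

lemma simple_reflection_pos:
  assumes \<alpha>: "\<alpha> \<in> simple_roots D" and \<beta>: "\<beta> \<in> pos_roots D" and ne: "\<beta> \<noteq> \<alpha>"
  shows "s \<alpha> *v \<beta> \<in> pos_roots D"
proof (rule ccontr)
  assume "s \<alpha> *v \<beta> \<notin> pos_roots D"
  then have "- (s \<alpha> *v \<beta>) \<in> pos_roots D"
    using pos_or_neg[OF reflection_root[OF simple_root[OF \<alpha>] pos_root[OF \<beta>]]] by blast
  then obtain d :: "int ^ 'n \<Rightarrow> nat" where d: "- (s \<alpha> *v \<beta>) = (\<Sum>\<gamma>\<in>simple_roots D. int (d \<gamma>) *s \<gamma>)"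
    unfolding pos_roots_def by blast
  obtain c :: "int ^ 'n \<Rightarrow> nat" where c: "\<beta> = (\<Sum>\<gamma>\<in>simple_roots D. int (c \<gamma>) *s \<gamma>)"
    using \<beta> unfolding pos_roots_def by blast
  define p where "p = pairing \<beta> (coroot D \<alpha>)"
  \<comment> \<open>Coordinates of the vanishing vector \<beta> - s_\<alpha> \<beta> - p \<alpha>.
    Away from \<alpha> they are sums of two naturals, so both summands vanish.\<close>
  define e where "e = (\<lambda>\<gamma>. int (c \<gamma>) + int (d \<gamma>) - (if \<gamma> = \<alpha> then p else 0))"
  have "(\<Sum>\<gamma>\<in>simple_roots D. (if \<gamma> = \<alpha> then p else 0) *s \<gamma>) = (\<Sum>\<gamma>\<in>simple_roots D. if \<gamma> = \<alpha> then p *s \<gamma> else 0)"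
    by (intro sum.cong) auto
  also have "\<dots> = p *s \<alpha>" using \<alpha> finite_simple by simp
  finally have "(\<Sum>\<gamma>\<in>simple_roots D. e \<gamma> *s \<gamma>) = \<beta> + - (s \<alpha> *v \<beta>) - p *s \<alpha>"
    unfolding e_def vector_ssub_ldistrib vector_sub_rdistrib vector_sadd_rdistrib sum_subtractf sum.distrib
    by (simp add: c[symmetric] d[symmetric])
  also have "\<dots> = 0" by (simp add: reflection_apply p_def)
  finally have e0: "\<forall>\<gamma>\<in>simple_roots D. e \<gamma> = 0" using simple_independent by blast
  have "(\<Sum>\<gamma>\<in>simple_roots D. int (c \<gamma>) *s \<gamma>) = (\<Sum>\<gamma>\<in>simple_roots D. if \<gamma> = \<alpha> then int (c \<alpha>) *s \<alpha> else 0)"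
    using e0 by (intro sum.cong) (auto simp: e_def split: if_splits)
  also have "\<dots> = int (c \<alpha>) *s \<alpha>" using \<alpha> finite_simple by simp
  finally have \<beta>\<alpha>: "\<beta> = int (c \<alpha>) *s \<alpha>" using c by simp
  \<comment> \<open>An integer factorization of 2, so the multiple is 1 or 2; the former is excluded
    by \<open>ne\<close>, the latter by \<open>double_not_root\<close>.\<close>
  have "int (c \<alpha>) * pairing \<alpha> (coroot D \<beta>) = 2"
    using pairing_coroot[OF pos_root[OF \<beta>]] \<beta>\<alpha> pairing_scale_left by metis
  then have "int (c \<alpha>) dvd 2" by (metis dvd_triv_left)
  then have "c \<alpha> dvd 2" by presburger
  then have "c \<alpha> = 1 \<or> c \<alpha> = 2" using two_is_prime_nat prime_nat_iff by blast
  then have "\<beta> = 1 *s \<alpha> \<or> \<beta> = 2 *s \<alpha>" using \<beta>\<alpha> by auto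
  then show False
    using ne double_not_root[OF simple_root[OF \<alpha>]] pos_root[OF \<beta>] by auto
qed

lemma word_prod_weyl: "set \<alpha>s \<subseteq> simple_roots D \<Longrightarrow> word_prod D \<alpha>s \<in> W"
  by (induction \<alpha>s) (auto intro: weyl_group.one weyl_group.step dest: simple_root)

text \<open>Reading the word from the left moves \<beta> to s_\<alpha> \<beta>, which stays positive
  until \<beta> equals the current letter. That letter is deleted, and
  \<open>reflection_conj\<close> turns the reflection in the moved root back into s_\<beta> on the
  way out. The word may be unreduced, which keeps the induction free of length conditions.\<close>

lemma exchange:
  assumes "set \<alpha>s \<subseteq> simple_roots D" "\<beta> \<in> pos_roots D"
    "- (matrix_inv (word_prod D \<alpha>s) *v \<beta>) \<in> pos_roots D"
  shows "\<exists>\<beta>s. set \<beta>s \<subseteq> simple_roots D \<and> length \<beta>s < length \<alpha>s \<and>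
    word_prod D \<beta>s = s \<beta> ** word_prod D \<alpha>s"
  using assms
proof (induction \<alpha>s arbitrary: \<beta>)
  case Nil
  have "matrix_inv (mat 1 :: int ^ 'n ^ 'n) = mat 1" by (rule matrix_inv_unique) simp_all
  then show ?case using Nil pos_not_neg by simp
next
  case (Cons \<alpha> \<alpha>s)
  let ?w = "word_prod D \<alpha>s"
  have \<alpha>: "\<alpha> \<in> simple_roots D" "\<alpha> \<in> roots D" and w: "?w \<in> W"
    using Cons.prems simple_root word_prod_weyl by auto
  show ?case
  proof (cases "\<beta> = \<alpha>")
    case True
    then show ?thesis using Cons.prems \<alpha>
      by (intro exI[of _ \<alpha>s]) (simp add: reflection_involution')
  next
    case False
    then have \<beta>': "s \<alpha> *v \<beta> \<in> pos_roots D" using simple_reflection_pos \<alpha> Cons.prems by blast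
    have "matrix_inv (word_prod D (\<alpha> # \<alpha>s)) *v \<beta> = matrix_inv ?w *v (s \<alpha> *v \<beta>)"
      using inv_reflection_mult_apply[OF w \<alpha>(2)] by simp
    then obtain \<beta>s where \<beta>s: "set \<beta>s \<subseteq> simple_roots D" "length \<beta>s < length \<alpha>s"
        "word_prod D \<beta>s = s (s \<alpha> *v \<beta>) ** ?w"
      using Cons.IH[OF _ \<beta>'] Cons.prems by auto
    have "word_prod D (\<alpha> # \<beta>s) = s \<alpha> ** (s \<alpha> ** s \<beta> ** s \<alpha> ** ?w)"
      by (simp add: \<beta>s reflection_conj[OF \<alpha>(2) pos_root[OF Cons.prems(2)]])
    also have "\<dots> = s \<beta> ** word_prod D (\<alpha> # \<alpha>s)"
      by (simp add: matrix_mul_assoc[symmetric] reflection_involution'[OF \<alpha>(2)])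
    finally show ?thesis using \<beta>s \<alpha> by (intro exI[of _ "\<alpha> # \<beta>s"]) simp
  qed
qed

lemma length_reflection_less:
  assumes w: "w \<in> W" and \<beta>: "\<beta> \<in> pos_roots D" and "- (matrix_inv w *v \<beta>) \<in> pos_roots D"
  shows "len (s \<beta> ** w) < len w"
proof -
  obtain \<alpha>s where "reduced_word D \<alpha>s w" using simple_generation[OF w] by blast
  then have \<alpha>s: "set \<alpha>s \<subseteq> simple_roots D" "word_prod D \<alpha>s = w" "length \<alpha>s = len w"
    unfolding reduced_word_def by auto
  then obtain \<beta>s where "set \<beta>s \<subseteq> simple_roots D" "length \<beta>s < length \<alpha>s" "word_prod D \<beta>s = s \<beta> ** w"
    using exchange[OF \<alpha>s(1) \<beta>] assms by metis
  then show ?thesis using weyl_length_le[of \<beta>s D] \<alpha>s by simp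
qed

text \<open>The inverse of s_\<beta> w sends \<beta> to the negative of its image under the inverse
  of w, so \<open>length_reflection_less\<close> applies to s_\<beta> w and leads back down to
  w.\<close>

lemma length_reflection_greater:
  assumes w: "w \<in> W" and \<beta>: "\<beta> \<in> pos_roots D" and "matrix_inv w *v \<beta> \<in> pos_roots D"
  shows "len w < len (s \<beta> ** w)"
proof -
  note \<beta>' = pos_root[OF \<beta>]
  have "matrix_inv (s \<beta> ** w) *v \<beta> = matrix_inv w *v (s \<beta> *v \<beta>)"
    using inv_reflection_mult_apply[OF w \<beta>'] by simp
  then have "- (matrix_inv (s \<beta> ** w) *v \<beta>) \<in> pos_roots D"
    using assms by (simp add: reflection_self[OF \<beta>'] matrix_vector_minus)
  from length_reflection_less[OF weyl_group.step[OF \<beta>' w] \<beta> this] show ?thesis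
    by (simp add: reflection_involution'[OF \<beta>'])
qed

lemma length_reflection_greater_iff:
  assumes "w \<in> W" and "\<beta> \<in> pos_roots D"
  shows "len w < len (s \<beta> ** w) \<longleftrightarrow> matrix_inv w *v \<beta> \<in> pos_roots D"
  using length_reflection_greater[OF assms] length_reflection_less[OF assms]
    pos_or_neg[OF weyl_root[OF weyl_inv[OF assms(1)] pos_root[OF assms(2)]]] by auto

lemma length_simple_reflection_le:
  assumes "w \<in> W" "\<alpha> \<in> simple_roots D"
  shows "len (s \<alpha> ** w) \<le> Suc (len w)"
proof -
  obtain \<alpha>s where "reduced_word D \<alpha>s w" using simple_generation[OF assms(1)] by blast
  then show ?thesis using weyl_length_le[of "\<alpha> # \<alpha>s" D] assms(2) unfolding reduced_word_def by auto
qed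

text \<open>The group acts faithfully on the finite set of roots: if w fixes all roots and a reduced
  word of w starts with \<alpha>, then s_\<alpha> w is shorter than w, although the inverse of w
  keeps \<alpha> positive and so s_\<alpha> w should be longer.\<close>

lemma finite_weyl_group: "finite W"
proof -
  have fixer: "w = mat 1" if w: "w \<in> W" and fix_roots: "\<And>\<beta>. \<beta> \<in> roots D \<Longrightarrow> w *v \<beta> = \<beta>" for w
  proof -
    obtain \<alpha>s where "reduced_word D \<alpha>s w" using simple_generation[OF w] by blast
    then have \<alpha>s: "set \<alpha>s \<subseteq> simple_roots D" "word_prod D \<alpha>s = w" "length \<alpha>s = len w"
      unfolding reduced_word_def by auto
    show ?thesis
    proof (cases \<alpha>s)
      case Nil
      then show ?thesis using \<alpha>s by simp
    next
      case (Cons \<alpha> \<beta>s)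
      then have \<alpha>: "\<alpha> \<in> simple_roots D" and \<beta>s: "set \<beta>s \<subseteq> simple_roots D" using \<alpha>s by auto
      have "s \<alpha> ** w = word_prod D \<beta>s"
        using \<alpha>s(2) Cons simple_root[OF \<alpha>] by (auto simp: reflection_involution')
      then have "len (s \<alpha> ** w) < len w" using weyl_length_le[OF \<beta>s] \<alpha>s Cons by simp
      moreover have "matrix_inv w *v \<alpha> = \<alpha>"
        using fix_roots[OF simple_root[OF \<alpha>]] weyl_inv_left[OF w]
        by (metis matrix_vector_mul_assoc matrix_vector_mul_lid)
      ultimately show ?thesis
        using length_reflection_greater[OF w simple_pos[OF \<alpha>]] simple_pos[OF \<alpha>] by simp
    qed
  qed
  have "inj_on (\<lambda>w. restrict ((*v) w) (roots D)) W"
  proof (rule inj_onI)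
    fix v w assume vw: "v \<in> W" "w \<in> W" "restrict ((*v) v) (roots D) = restrict ((*v) w) (roots D)"
    have "(matrix_inv v ** w) *v \<beta> = \<beta>" if "\<beta> \<in> roots D" for \<beta>
    proof -
      have "w *v \<beta> = v *v \<beta>" using fun_cong[OF vw(3), of \<beta>] that by simp
      then show ?thesis
        by (simp add: matrix_vector_mul_assoc[symmetric])
          (simp add: matrix_vector_mul_assoc weyl_inv_left[OF vw(1)])
    qed
    then have "matrix_inv v ** w = mat 1"
      using fixer weyl_group_mult[OF weyl_inv[OF vw(1)] vw(2)] by blast
    then show "v = w" using weyl_inv_right'[OF vw(1), of w] by simp
  qed
  moreover have "(\<lambda>w. restrict ((*v) w) (roots D)) ` W \<subseteq> roots D \<rightarrow>\<^sub>E roots D"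
    using weyl_root by auto
  ultimately show ?thesis
    using finite_PiE[OF finite_roots finite_roots] inj_on_finite by blast
qed

section \<open>The Bruhat order and its lifting property\<close>

lemma bruhat_weyl: "bruhat_le D v w \<Longrightarrow> v \<in> W \<and> w \<in> W"
  by (simp add: bruhat_le_def)

lemma bruhat_refl: "w \<in> W \<Longrightarrow> bruhat_le D w w"
  by (simp add: bruhat_le_def)

lemma bruhat_trans: "bruhat_le D u v \<Longrightarrow> bruhat_le D v w \<Longrightarrow> bruhat_le D u w"
  unfolding bruhat_le_def by auto

lemma bruhat_step_le: "v \<in> W \<Longrightarrow> bruhat_step D v w \<Longrightarrow> bruhat_le D v w"
  unfolding bruhat_le_def bruhat_step_def using weyl_group.step by (auto simp: bruhat_step_def)

text \<open>Makes the length a rank function for the later triangular inversion and yields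
  antisymmetry.\<close>

lemma bruhat_length: "bruhat_le D v w \<Longrightarrow> v \<noteq> w \<Longrightarrow> len v < len w"
proof -
  have "v = w \<or> len v < len w" if "(bruhat_step D)\<^sup>*\<^sup>* v w"
    using that by induction (auto simp: bruhat_step_def)
  then show "bruhat_le D v w \<Longrightarrow> v \<noteq> w \<Longrightarrow> len v < len w" unfolding bruhat_le_def by blast
qed

lemma finite_bruhat: "finite {v. bruhat_le D v w}"
  by (rule finite_subset[OF _ finite_weyl_group]) (auto dest: bruhat_weyl)

lemma bruhat_simple_step:
  assumes "w \<in> W" "\<alpha> \<in> roots D" "len w < len (s \<alpha> ** w)"
  shows "bruhat_le D w (s \<alpha> ** w)"
  using assms by (intro bruhat_step_le) (auto simp: bruhat_step_def)

text \<open>For the step along a positive root \<beta> other than \<alpha>, the root s_\<alpha>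
  \<beta> is again positive, and the inverse of s_\<alpha> x sends it where the inverse of x sends
  \<beta>. So the step from s_\<alpha> x to s_\<alpha> y also goes up.\<close>

lemma bruhat_step_lift:
  assumes x: "x \<in> W" and \<alpha>: "\<alpha> \<in> simple_roots D" and xy: "bruhat_step D x y"
  shows "s \<alpha> ** x = y \<or> bruhat_step D (s \<alpha> ** x) (s \<alpha> ** y)"
proof -
  note \<alpha>' = simple_root[OF \<alpha>]
  obtain \<beta>' where \<beta>': "\<beta>' \<in> roots D" "y = s \<beta>' ** x" and l: "len x < len y"
    using xy unfolding bruhat_step_def by blast
  obtain \<beta> where \<beta>: "\<beta> \<in> pos_roots D" and y: "y = s \<beta> ** x"
    using pos_or_neg[OF \<beta>'(1)] \<beta>' reflection_uminus by metis
  note \<beta>r = pos_root[OF \<beta>]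
  have pos: "matrix_inv x *v \<beta> \<in> pos_roots D"
    using l y length_reflection_greater_iff[OF x \<beta>] by simp
  show ?thesis
  proof (cases "\<beta> = \<alpha>")
    case True
    then show ?thesis using y by simp
  next
    case False
    then have p: "s \<alpha> *v \<beta> \<in> pos_roots D" using simple_reflection_pos \<alpha> \<beta> by blast
    have "matrix_inv (s \<alpha> ** x) *v (s \<alpha> *v \<beta>) = matrix_inv x *v (s \<alpha> *v (s \<alpha> *v \<beta>))"
      using inv_reflection_mult_apply[OF x \<alpha>'] by simp
    then have "matrix_inv (s \<alpha> ** x) *v (s \<alpha> *v \<beta>) \<in> pos_roots D"
      using pos by (simp add: reflection_involution_apply[OF \<alpha>'])
    from length_reflection_greater[OF weyl_group.step[OF \<alpha>' x] p this]
    have "len (s \<alpha> ** x) < len (s (s \<alpha> *v \<beta>) ** (s \<alpha> ** x))" .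
    moreover have "s (s \<alpha> *v \<beta>) ** (s \<alpha> ** x) = s \<alpha> ** y"
      by (simp add: reflection_conj[OF \<alpha>' \<beta>r] y matrix_mul_assoc[symmetric] reflection_involution'[OF \<alpha>'])
    ultimately show ?thesis using reflection_root[OF \<alpha>' \<beta>r] unfolding bruhat_step_def by metis
  qed
qed

text \<open>A chain from v to w is lifted step by step. At a step where s_\<alpha> x = y the lifting
  stops, and the rest of the original chain is followed by the step from w up to s_\<alpha>
  w.\<close>

lemma bruhat_lift:
  assumes vw: "bruhat_le D v w" and \<alpha>: "\<alpha> \<in> simple_roots D" and l: "len w < len (s \<alpha> ** w)"
  shows "bruhat_le D (s \<alpha> ** v) (s \<alpha> ** w)"
proof -
  have w: "w \<in> W" and v: "v \<in> W" using bruhat_weyl[OF vw] by auto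
  have w_le: "bruhat_le D w (s \<alpha> ** w)"
    using bruhat_simple_step[OF w simple_root[OF \<alpha>] l] .
  have "(bruhat_step D)\<^sup>*\<^sup>* v w" using vw by (simp add: bruhat_le_def)
  then have "v \<in> W \<longrightarrow> bruhat_le D (s \<alpha> ** v) (s \<alpha> ** w)"
  proof (induction rule: converse_rtranclp_induct)
    case base
    then show ?case using bruhat_refl weyl_group.step simple_root[OF \<alpha>] by blast
  next
    case (step x y)
    show ?case
    proof
      assume x: "x \<in> W"
      then have y: "y \<in> W" using bruhat_weyl[OF bruhat_step_le[OF x step(1)]] by simp
      have sx: "s \<alpha> ** x \<in> W" using x weyl_group.step simple_root[OF \<alpha>] by blast
      from bruhat_step_lift[OF x \<alpha> step(1)]
      show "bruhat_le D (s \<alpha> ** x) (s \<alpha> ** w)"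
      proof
        assume "s \<alpha> ** x = y"
        moreover have "bruhat_le D y w" using step(2) y w by (simp add: bruhat_le_def)
        ultimately show ?thesis using w_le bruhat_trans by metis
      next
        assume "bruhat_step D (s \<alpha> ** x) (s \<alpha> ** y)"
        then show ?thesis using bruhat_step_le[OF sx] bruhat_trans step(3) y by blast
      qed
    qed
  qed
  then show ?thesis using v by simp
qed

section \<open>Inversion sets under left multiplication by a simple reflection\<close>

lemma finite_inversions: "finite (inversions D w)"
  by (rule finite_subset[OF _ finite_roots]) (auto simp: inversions_def pos_root)

text \<open>Again s_\<alpha> permutes the positive roots other than \<alpha>, and the length
  condition says that \<alpha> is a new inversion. The disjoint union is the recursion behind the
  product formula on the diagonal.\<close>

lemma inversions_simple_mult:
  assumes w: "w \<in> W" and \<alpha>: "\<alpha> \<in> simple_roots D" and l: "len w < len (s \<alpha> ** w)"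
  shows "inversions D (s \<alpha> ** w) = insert \<alpha> ((*v) (s \<alpha>) ` inversions D w)"
    and "\<alpha> \<notin> (*v) (s \<alpha>) ` inversions D w"
proof -
  note \<alpha>' = simple_root[OF \<alpha>]
  have pos: "matrix_inv w *v \<alpha> \<in> pos_roots D"
    using length_reflection_greater_iff[OF w simple_pos[OF \<alpha>]] l by simp
  then have \<alpha>_notin: "\<alpha> \<notin> inversions D w" using pos_not_neg unfolding inversions_def by auto
  have inv: "matrix_inv (s \<alpha> ** w) *v \<beta> = matrix_inv w *v (s \<alpha> *v \<beta>)" for \<beta>
    using inv_reflection_mult_apply[OF w \<alpha>'] by simp
  have image: "s \<alpha> *v \<beta> \<in> inversions D w \<longleftrightarrow> \<beta> \<in> inversions D (s \<alpha> ** w)" if "\<beta> \<in> pos_roots D" "\<beta> \<noteq> \<alpha>" for \<beta>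
    using simple_reflection_pos[OF \<alpha> that] that by (simp add: inversions_def inv)
  have pos_image: "s \<alpha> *v \<beta> \<in> pos_roots D \<and> s \<alpha> *v \<beta> \<noteq> \<alpha>" if "\<beta> \<in> inversions D w" for \<beta>
  proof -
    have "\<beta> \<in> pos_roots D" "\<beta> \<noteq> \<alpha>" using that \<alpha>_notin unfolding inversions_def by auto
    moreover have "s \<alpha> *v \<beta> \<noteq> \<alpha>"
    proof
      assume "s \<alpha> *v \<beta> = \<alpha>"
      then have "\<beta> = - \<alpha>" using reflection_involution_apply[OF \<alpha>', of \<beta>] reflection_self[OF \<alpha>'] by simp
      then show False using pos_not_neg[OF simple_pos[OF \<alpha>]] \<open>\<beta> \<in> pos_roots D\<close> by simp
    qed
    ultimately show ?thesis using simple_reflection_pos[OF \<alpha>] by blast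
  qed
  show "\<alpha> \<notin> (*v) (s \<alpha>) ` inversions D w"
  proof
    assume "\<alpha> \<in> (*v) (s \<alpha>) ` inversions D w"
    then obtain \<beta> where "\<beta> \<in> inversions D w" "\<alpha> = s \<alpha> *v \<beta>" by (rule imageE)
    then show False using pos_image[of \<beta>] by simp
  qed
  show "inversions D (s \<alpha> ** w) = insert \<alpha> ((*v) (s \<alpha>) ` inversions D w)"
  proof (intro equalityI subsetI)
    fix \<beta> assume \<beta>: "\<beta> \<in> inversions D (s \<alpha> ** w)"
    then have "\<beta> \<in> pos_roots D" by (simp add: inversions_def)
    then have "\<beta> = \<alpha> \<or> s \<alpha> *v \<beta> \<in> inversions D w" using image[of \<beta>] \<beta> by (cases "\<beta> = \<alpha>") simp_all
    moreover have "\<beta> \<in> (*v) (s \<alpha>) ` inversions D w" if "s \<alpha> *v \<beta> \<in> inversions D w"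
      by (rule image_eqI[OF _ that]) (simp add: reflection_involution_apply[OF \<alpha>'])
    ultimately show "\<beta> \<in> insert \<alpha> ((*v) (s \<alpha>) ` inversions D w)" by (elim disjE) simp_all
  next
    fix \<beta> assume "\<beta> \<in> insert \<alpha> ((*v) (s \<alpha>) ` inversions D w)"
    then show "\<beta> \<in> inversions D (s \<alpha> ** w)"
    proof
      assume "\<beta> = \<alpha>"
      then show ?thesis using simple_pos[OF \<alpha>] pos
        by (simp add: inversions_def inv reflection_self[OF \<alpha>'] matrix_vector_minus)
    next
      assume "\<beta> \<in> (*v) (s \<alpha>) ` inversions D w"
      then obtain \<gamma> where \<gamma>: "\<gamma> \<in> inversions D w" "\<beta> = s \<alpha> *v \<gamma>" by blast
      then show ?thesis
        using image[of \<beta>] pos_image[OF \<gamma>(1)] reflection_involution_apply[OF \<alpha>', of \<gamma>] by simp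
    qed
  qed
qed

end

section \<open>Actions on meromorphic functions\<close>

lemma mero_cases:
  obtains f where "meromorphic_rep f" "a = mero_fun f"
  using rep_mero_meromorphic mero_fun_rep_mero by metis

lemma mero_fun_add:
  "meromorphic_rep f \<Longrightarrow> meromorphic_rep g \<Longrightarrow> mero_fun f + mero_fun g = mero_fun (\<lambda>x. f x + g x)"
  unfolding mero_fun_def by (rule plus_mero.abs_eq) (simp_all add: mero_rel_def generic_eq_refl)

lemma mero_fun_mult:
  "meromorphic_rep f \<Longrightarrow> meromorphic_rep g \<Longrightarrow> mero_fun f * mero_fun g = mero_fun (\<lambda>x. f x * g x)"
  unfolding mero_fun_def by (rule times_mero.abs_eq) (simp_all add: mero_rel_def generic_eq_refl)

lemma mero_fun_inverse:
  "meromorphic_rep f \<Longrightarrow> inverse (mero_fun f) = mero_fun (\<lambda>x. inverse (f x))"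
  unfolding mero_fun_def by (rule inverse_mero.abs_eq) (simp_all add: mero_rel_def generic_eq_refl)

lemma mero_fun_0: "mero_fun (\<lambda>_. 0) = 0"
  unfolding mero_fun_def by (rule zero_mero.abs_eq[symmetric])

lemma mero_fun_1: "mero_fun (\<lambda>_. 1) = 1"
  unfolding mero_fun_def by (rule one_mero.abs_eq[symmetric])

lemma cmat_vector: "cvec (A *v x) = cmat A *v cvec x"
  by (simp add: cvec_def cmat_def matrix_vector_mult_def vec_eq_iff)

lemma cmat_transpose: "cmat (transpose A) = transpose (cmat A)"
  by (simp add: cmat_def transpose_def vec_eq_iff)

lemma clinear_equiv_act_z:
  fixes w :: "int ^ 'n ^ 'n::finite"
  assumes "invertible w"
  shows "clinear_equiv (\<lambda>p. (transpose (cmat w) *v fst p, snd p))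
    (\<lambda>p. (transpose (cmat (matrix_inv w)) *v fst p, snd p))"
proof -
  have "clinear_equiv (\<lambda>p. (transpose (cmat w) *v fst p, mat 1 *v snd p))
     (\<lambda>p. (transpose (cmat (matrix_inv w)) *v fst p, mat 1 *v snd p))"
    by (rule clinear_equiv_matrices)
      (simp_all add: matrix_transpose_mul[symmetric] cmat_mult[symmetric] matrix_inv_int[OF assms] cmat_one)
  then show ?thesis by simp
qed

lemma clinear_equiv_act_d:
  fixes w :: "int ^ 'n ^ 'n::finite"
  assumes "invertible w"
  shows "clinear_equiv (\<lambda>p. (fst p, cmat (matrix_inv w) *v snd p)) (\<lambda>p. (fst p, cmat w *v snd p))"
proof -
  have "clinear_equiv (\<lambda>p. (mat 1 *v fst p, cmat (matrix_inv w) *v snd p))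
     (\<lambda>p. (mat 1 *v fst p, cmat w *v snd p))"
    by (rule clinear_equiv_matrices)
      (simp_all add: cmat_mult[symmetric] matrix_inv_int[OF assms] cmat_one)
  then show ?thesis by simp
qed

lemma act_z_rep:
  assumes "invertible w" "meromorphic_rep f"
  shows "act_z w (mero_fun f) = mero_fun (\<lambda>p. f (transpose (cmat w) *v fst p, snd p))"
    and "meromorphic_rep (\<lambda>p. f (transpose (cmat w) *v fst p, snd p))"
  using act_z_mero_fun[OF assms] meromorphic_rep_pullback[OF clinear_equiv_act_z[OF assms(1)] assms(2)]
  by (simp_all add: case_prod_unfold)

lemma act_d_rep:
  assumes "invertible w" "meromorphic_rep f"
  shows "act_d w (mero_fun f) = mero_fun (\<lambda>p. f (fst p, cmat (matrix_inv w) *v snd p))"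
    and "meromorphic_rep (\<lambda>p. f (fst p, cmat (matrix_inv w) *v snd p))"
  using act_d_mero_fun[OF assms] meromorphic_rep_pullback[OF clinear_equiv_act_d[OF assms(1)] assms(2)]
  by (simp_all add: case_prod_unfold)

lemma act_z_hom:
  assumes w: "invertible w"
  shows act_z_add: "act_z w (a + b) = act_z w a + act_z w b"
    and act_z_mult: "act_z w (a * b) = act_z w a * act_z w b"
    and act_z_inverse: "act_z w (inverse a) = inverse (act_z w a)"
    and act_z_0: "act_z w 0 = 0"
    and act_z_1: "act_z w 1 = 1"
proof -
  obtain f g where fg: "meromorphic_rep f" "a = mero_fun f" "meromorphic_rep g" "b = mero_fun g"
    by (metis mero_cases)
  note r = act_z_rep[OF w]
  show "act_z w (a + b) = act_z w a + act_z w b" "act_z w (a * b) = act_z w a * act_z w b"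
    "act_z w (inverse a) = inverse (act_z w a)"
    using fg by (simp_all add: mero_fun_add mero_fun_mult mero_fun_inverse r
        meromorphic_rep_add meromorphic_rep_mult meromorphic_rep_inverse)
  show "act_z w 0 = 0" "act_z w 1 = 1"
    unfolding mero_fun_0[symmetric] mero_fun_1[symmetric] by (simp_all add: r meromorphic_rep_const)
qed

lemma act_d_hom:
  assumes w: "invertible w"
  shows act_d_add: "act_d w (a + b) = act_d w a + act_d w b"
    and act_d_mult: "act_d w (a * b) = act_d w a * act_d w b"
    and act_d_inverse: "act_d w (inverse a) = inverse (act_d w a)"
    and act_d_0: "act_d w 0 = 0"
    and act_d_1: "act_d w 1 = 1"
proof -
  obtain f g where fg: "meromorphic_rep f" "a = mero_fun f" "meromorphic_rep g" "b = mero_fun g"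
    by (metis mero_cases)
  note r = act_d_rep[OF w]
  show "act_d w (a + b) = act_d w a + act_d w b" "act_d w (a * b) = act_d w a * act_d w b"
    "act_d w (inverse a) = inverse (act_d w a)"
    using fg by (simp_all add: mero_fun_add mero_fun_mult mero_fun_inverse r
        meromorphic_rep_add meromorphic_rep_mult meromorphic_rep_inverse)
  show "act_d w 0 = 0" "act_d w 1 = 1"
    unfolding mero_fun_0[symmetric] mero_fun_1[symmetric] by (simp_all add: r meromorphic_rep_const)
qed

lemma act_z_divide: "invertible w \<Longrightarrow> act_z w (a / b) = act_z w a / act_z w b"
  by (simp add: divide_inverse act_z_hom)

lemma act_d_divide: "invertible w \<Longrightarrow> act_d w (a / b) = act_d w a / act_d w b"
  by (simp add: divide_inverse act_d_hom)

lemma act_z_prod: "invertible w \<Longrightarrow> act_z w (\<Prod>x\<in>A. f x) = (\<Prod>x\<in>A. act_z w (f x))"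
  by (induction A rule: infinite_finite_induct) (simp_all add: act_z_hom)

lemma act_d_prod: "invertible w \<Longrightarrow> act_d w (\<Prod>x\<in>A. f x) = (\<Prod>x\<in>A. act_d w (f x))"
  by (induction A rule: infinite_finite_induct) (simp_all add: act_d_hom)

lemma act_d_sum: "invertible w \<Longrightarrow> act_d w (\<Sum>x\<in>A. f x) = (\<Sum>x\<in>A. act_d w (f x))"
  by (induction A rule: infinite_finite_induct) (simp_all add: act_d_hom)

lemma matrix_inv_one: "matrix_inv (mat 1 :: int ^ 'n ^ 'n::finite) = mat 1"
  by (rule matrix_inv_unique) simp_all

lemma act_z_one [simp]: "act_z (mat 1) a = a"
  by (simp add: act_z_def cmat_one transpose_mat mero_fun_rep_mero)

lemma act_d_one [simp]: "act_d (mat 1) a = a"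
  by (simp add: act_d_def cmat_one matrix_inv_one mero_fun_rep_mero)

text \<open>The inverse in the definition of \<open>act_d\<close> makes precomposition a left
  action.\<close>

lemma act_d_compose:
  fixes u v :: "int ^ 'n ^ 'n::finite"
  assumes u: "invertible u" and v: "invertible v"
  shows "act_d u (act_d v a) = act_d (u ** v) a"
proof -
  have "matrix_inv (u ** v) = matrix_inv v ** matrix_inv u"
  proof (rule matrix_inv_unique)
    have "u ** v ** (matrix_inv v ** matrix_inv u) = u ** (v ** matrix_inv v) ** matrix_inv u"
      "matrix_inv v ** matrix_inv u ** (u ** v) = matrix_inv v ** (matrix_inv u ** u) ** v"
      by (simp_all add: matrix_mul_assoc)
    then show "u ** v ** (matrix_inv v ** matrix_inv u) = mat 1"
      "matrix_inv v ** matrix_inv u ** (u ** v) = mat 1"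
      by (simp_all add: matrix_inv_int[OF u] matrix_inv_int[OF v])
  qed
  moreover have "invertible (u ** v)"
    unfolding invertible_def
    using u v by (metis invertible_def matrix_mul_assoc matrix_mul_rid)
  moreover obtain f where "meromorphic_rep f" "a = mero_fun f" by (metis mero_cases)
  ultimately show ?thesis
    using u v by (simp add: act_d_rep cmat_mult matrix_vector_mul_assoc)
qed

lemma act_d_eq_0_iff:
  fixes w :: "int ^ 'n ^ 'n::finite"
  assumes "invertible w"
  shows "act_d w a = 0 \<longleftrightarrow> a = 0"
proof
  assume "act_d w a = 0"
  have "invertible (matrix_inv w)" unfolding invertible_def using matrix_inv_int[OF assms] by blast
  then have "act_d (matrix_inv w) (act_d w a) = 0"
    using \<open>act_d w a = 0\<close> by (simp add: act_d_0)
  then show "a = 0"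
    by (simp add: act_d_compose \<open>invertible (matrix_inv w)\<close> assms matrix_inv_int[OF assms])
qed (simp add: act_d_0 assms)

lemma act_z_theta_mero:
  assumes "Im \<tau> > 0" "mholomorphic_on u UNIV" "invertible w"
  shows "act_z w (theta_mero \<tau> u) = theta_mero \<tau> (\<lambda>p. u (transpose (cmat w) *v fst p, snd p))"
  unfolding theta_mero_def using act_z_rep(1)[OF assms(3) theta_meromorphic[OF assms(1,2)]] .

lemma act_d_theta_mero:
  assumes "Im \<tau> > 0" "mholomorphic_on u UNIV" "invertible w"
  shows "act_d w (theta_mero \<tau> u) = theta_mero \<tau> (\<lambda>p. u (fst p, cmat (matrix_inv w) *v snd p))"
  unfolding theta_mero_def using act_d_rep(1)[OF assms(3) theta_meromorphic[OF assms(1,2)]] .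

lemma z_lin_act: "z_lin \<mu> (transpose (cmat w) *v x, y) = z_lin (w *v \<mu>) (x, y)"
  by (simp add: z_lin_def cmat_vector pairing_matrix_left)

lemma z_lin_snd: "z_lin \<mu> (x, y) = z_lin \<mu> (x, y')"
  by (simp add: z_lin_def)

lemma l_lin_fst: "l_lin \<nu> (x, y) = l_lin \<nu> (x', y)"
  by (simp add: l_lin_def)

text \<open>With the inverse of \<open>w\<close> in place of \<open>w\<close>, the right side is the
  Weyl action on cocharacters, as the dynamical action requires.\<close>

lemma l_lin_act: "l_lin \<nu> (x, cmat w *v y) = l_lin (transpose w *v \<nu>) (x, y)"
  by (simp add: l_lin_def cmat_vector cmat_transpose pairing_matrix_left)

section \<open>Nonvanishing of theta factors\<close>

text \<open>At 1/2 both exponentials in the product equal -1, so its factors are squares of 1 + q^s,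
  nonzero because |q| < 1; the sine-like prefactor is 1/\<pi>.\<close>

lemma theta_half_nonzero:
  assumes "Im \<tau> > 0"
  shows "theta \<tau> (1 / 2) \<noteq> 0"
proof -
  define q where "q = exp (2 * pi * \<i> * \<tau>)"
  have q: "norm q < 1" using assms by (simp add: q_def norm_exp_eq_Re)
  have pow: "norm (q ^ Suc k) < 1" for k
    using power_Suc_less_one[of "norm q" k] q by (cases "q = 0") (simp_all add: norm_mult norm_power)
  have ne: "1 + q ^ Suc k \<noteq> 0" "1 - q ^ Suc k \<noteq> 0" for k
    using pow[of k] by (auto simp: add_eq_0_iff simp del: power_Suc)
  have sm: "summable (\<lambda>k. norm (q ^ Suc k))"
    using q by (simp add: norm_mult norm_power summable_mult summable_geometric)
  have cp: "convergent_prod (\<lambda>k. 1 + q ^ Suc k)"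
    using sm by (intro abs_convergent_prod_imp_convergent_prod summable_imp_abs_convergent_prod)
      (simp del: power_Suc)
  have cm: "convergent_prod (\<lambda>k. 1 - q ^ Suc k)"
    using sm by (intro abs_convergent_prod_imp_convergent_prod summable_imp_abs_convergent_prod)
      (simp del: power_Suc)
  have e: "exp (2 * pi * \<i> * (1 / 2)) = -1" "exp (- (2 * pi * \<i> * (1 / 2))) = -1"
    by (simp_all add: exp_minus mult.commute[of _ \<i>])
  have f: "exp (pi * \<i> * (1 / 2)) = \<i>" "exp (- (pi * \<i> * (1 / 2))) = - \<i>"
    by (simp_all add: exp_minus exp_eq_polar cis_conv_exp[symmetric] mult.commute[of _ \<i>])
  have "(\<Prod>k. (1 + q ^ Suc k) * (1 + q ^ Suc k)) \<noteq> 0"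
    using ne by (intro prodinf_nonzero convergent_prod_mult cp) (simp_all del: power_Suc)
  moreover have "(\<Prod>k. inverse ((1 - q ^ Suc k)\<^sup>2)) \<noteq> 0"
    using ne unfolding power2_eq_square
    by (intro prodinf_nonzero convergent_prod_inverse convergent_prod_mult cm) (simp_all del: power_Suc)
  ultimately show ?thesis
    unfolding theta_def Let_def q_def[symmetric] e f by (simp del: power_Suc)
qed

text \<open>A zero class vanishes on a dense set, hence everywhere by continuity, yet
  \<open>u\<close> takes the value 1/2.\<close>

lemma theta_mero_nonzero:
  assumes \<tau>: "Im \<tau> > 0" and u: "mholomorphic_on u UNIV" and "surj u"
  shows "theta_mero \<tau> u \<noteq> 0"
proof
  assume "theta_mero \<tau> u = 0"
  then have "generic_eq (\<lambda>p. theta \<tau> (u p)) (\<lambda>_. 0)"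
    unfolding theta_mero_def mero_fun_0[symmetric]
    using mero_fun_eq_iff[OF theta_meromorphic[OF \<tau> u] meromorphic_rep_const] by blast
  then obtain S where S: "open S" "closure S = UNIV" "\<forall>p\<in>S. theta \<tau> (u p) = 0"
    unfolding generic_eq_def by blast
  have "continuous_on (closure S) (\<lambda>p. theta \<tau> (u p))"
    using mholomorphic_on_isCont[OF mholomorphic_on_compose[OF theta_holomorphic[OF \<tau>] u]]
    by (intro continuous_at_imp_continuous_on) simp
  then have zero: "theta \<tau> (u p) = 0" for p
    using continuous_constant_on_closure[of S "\<lambda>p. theta \<tau> (u p)" 0 p] S by auto
  obtain p where "u p = 1 / 2" using \<open>surj u\<close> by (metis surj_def)
  then show False using zero[of p] theta_half_nonzero[OF \<tau>] by metis
qed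

lemma pairing_cvec: "pairing (cvec x) (cvec y) = of_int (pairing x y)"
  by (simp add: pairing_def cvec_def)

text \<open>To be used with a root and its coroot, whose pairing 2 explains the factor 1/2 in the
  preimage.\<close>

lemma surj_z_lin:
  assumes "pairing \<mu> \<nu> = 2"
  shows "surj (z_lin \<mu>)"
proof (rule surjI)
  show "z_lin \<mu> ((t / 2) *s cvec \<nu>, 0) = t" for t
    by (simp add: z_lin_def pairing_scale_right pairing_cvec assms)
qed

lemma surj_l_lin:
  assumes "pairing \<mu> \<nu> = 2"
  shows "surj (l_lin \<nu>)"
proof (rule surjI)
  show "l_lin \<nu> (0, (t / 2) *s cvec \<mu>) = t" for t
    by (simp add: l_lin_def pairing_scale_left pairing_cvec assms)
qed

lemma surj_const_minus:
  fixes c :: "'a::ab_group_add"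
  assumes "surj u"
  shows "surj (\<lambda>p. c - u p)"
  using assms unfolding surj_def by (metis diff_diff_eq2 add_diff_cancel_left')

lemma mholomorphic_on_const_minus:
  "mholomorphic_on u U \<Longrightarrow> mholomorphic_on (\<lambda>p. c - u p) U"
  using mholomorphic_on_add[OF mholomorphic_on_const[of c] mholomorphic_on_minus] by simp

section \<open>Elliptic Demazure--Lusztig operators of reduced words\<close>

lemma bitwisted_sum_apply:
  fixes F :: "'a \<Rightarrow> ('n::finite) bitwisted"
  shows "(\<Sum>x\<in>A. F x) v w = (\<Sum>x\<in>A. F x v w)"
  by (induction A rule: infinite_finite_induct) (simp_all add: plus_fun_def zero_fun_def)

text \<open>The monomial a \<delta>^d_w \<delta>_v. The arguments follow the index order of
  \<open>bitwisted\<close>, so the index of \<delta> comes before that of \<delta>^d.\<close>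

definition single :: "int ^ ('n::finite) ^ 'n \<Rightarrow> int ^ 'n ^ 'n \<Rightarrow> 'n mero \<Rightarrow> 'n bitwisted" where
  "single v w a = (\<lambda>v' w'. if v' = v \<and> w' = w then a else 0)"

lemma delta_single: "delta v = single v (mat 1) 1"
  by (simp add: delta_def single_def)

lemma delta_d_single: "delta_d w = single (mat 1) w 1"
  by (simp add: delta_d_def single_def)

lemma Q_smult_single: "Q_smult a (single v w b) = single v w (a * b)"
  by (intro ext) (simp add: Q_smult_def single_def)

lemma QWdW_mult_add_left: "QWdW_mult D (F + F') G = QWdW_mult D F G + QWdW_mult D F' G"
  by (intro ext) (simp add: QWdW_mult_def plus_fun_def case_prod_unfold distrib_right sum.distrib)

context simply_generated_root_datum
begin

section \<open>Products with monomials in the twisted algebra\<close>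

lemma sum_factorizations:
  "(\<Sum>(w, w')\<in>factorizations D x. f w w') = (if x \<in> W then \<Sum>w\<in>W. f w (matrix_inv w ** x) else 0)"
proof (cases "x \<in> W")
  case True
  have "factorizations D x = (\<lambda>w. (w, matrix_inv w ** x)) ` W"
    unfolding factorizations_def using True
    by (auto simp: weyl_inv_right' weyl_inv_left' weyl_group_mult weyl_inv)
  then show ?thesis using True by (simp add: sum.reindex inj_on_def)
next
  case False
  then have "factorizations D x = {}" unfolding factorizations_def using weyl_group_mult by auto
  then show ?thesis using False by simp
qed

lemma QWdW_mult_apply:
  "QWdW_mult D F G y x = (if y \<in> W \<and> x \<in> W then
     \<Sum>v\<in>W. \<Sum>w\<in>W. F v w * act_z v (act_d w (G (matrix_inv v ** y) (matrix_inv w ** x))) else 0)"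
  unfolding QWdW_mult_def sum_factorizations by simp

lemma QWdW_mult_single:
  assumes "v \<in> W" "w \<in> W"
  shows "QWdW_mult D (single v w a) G y x = (if y \<in> W \<and> x \<in> W then
     a * act_z v (act_d w (G (matrix_inv v ** y) (matrix_inv w ** x))) else 0)"
proof -
  have "(\<Sum>v'\<in>W. \<Sum>w'\<in>W. single v w a v' w' * X v' w') = a * X v w" for X
  proof -
    have "(\<Sum>w'\<in>W. single v w a v' w' * X v' w') = (if v' = v then a * X v w else 0)" for v'
    proof -
      have "(\<Sum>w'\<in>W. single v w a v' w' * X v' w') =
          (\<Sum>w'\<in>W. if w' = w then (if v' = v then a * X v w else 0) else 0)"
        by (intro sum.cong) (auto simp: single_def)
      then show ?thesis using assms finite_weyl_group by simp
    qed
    then show ?thesis using assms finite_weyl_group by simp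
  qed
  then show ?thesis unfolding QWdW_mult_apply by simp
qed

lemma weyl_one: "mat 1 \<in> W"
  by (rule weyl_group.one)

lemma QWdW_mult_single_single:
  assumes "v \<in> W" "w \<in> W" "v' \<in> W" "w' \<in> W"
  shows "QWdW_mult D (single v w a) (single v' w' b) = single (v ** v') (w ** w') (a * act_z v (act_d w b))"
proof (intro ext)
  fix y x
  have eq: "u' = matrix_inv u ** t \<longleftrightarrow> t = u ** u'" if "u \<in> W" for u u' t
    using weyl_inv_right'[OF that] weyl_inv_left'[OF that] by metis
  show "QWdW_mult D (single v w a) (single v' w' b) y x =
      single (v ** v') (w ** w') (a * act_z v (act_d w b)) y x"
    unfolding QWdW_mult_single[OF assms(1,2)] using assms
    by (auto simp: single_def eq eq_commute[of "matrix_inv _ ** _"] weyl_group_mult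
        act_z_0 act_d_0 weyl_is_invertible)
qed

end

locale elliptic_root_datum = simply_generated_root_datum D for D :: "('n::finite) root_datum" +
  fixes \<tau> h :: complex
  assumes Im_\<tau>: "Im \<tau> > 0"
begin

text \<open>Stated for all roots and not only simple ones, because the diagonal coefficient of a
  longer word involves the images of simple roots under simple reflections.\<close>

definition lead_coeff :: "int ^ 'n \<Rightarrow> 'n mero" where
  "lead_coeff \<beta> = theta_mero \<tau> (\<lambda>p. h - z_lin \<beta> p) * theta_mero \<tau> (l_lin (coroot D \<beta>))
     / (theta_mero \<tau> (z_lin \<beta>) * theta_mero \<tau> (\<lambda>p. h - l_lin (coroot D \<beta>) p))"

definition rest_coeff :: "int ^ 'n \<Rightarrow> 'n mero" where
  "rest_coeff \<beta> = theta_mero \<tau> (\<lambda>_. h) * theta_mero \<tau> (\<lambda>p. z_lin \<beta> p - l_lin (coroot D \<beta>) p)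
     / (theta_mero \<tau> (z_lin \<beta>) * theta_mero \<tau> (\<lambda>p. h - l_lin (coroot D \<beta>) p))"

text \<open>Every argument is a nonconstant affine function, whatever \<open>h\<close> is. The
  constant factor theta(h), which vanishes at h = 0, occurs only in \<open>rest_coeff\<close> and
  hence not on the diagonal.\<close>

lemma theta_root_nonzero:
  assumes "\<beta> \<in> roots D"
  shows "theta_mero \<tau> (z_lin \<beta>) \<noteq> 0" "theta_mero \<tau> (\<lambda>p. h - z_lin \<beta> p) \<noteq> 0"
    "theta_mero \<tau> (l_lin (coroot D \<beta>)) \<noteq> 0" "theta_mero \<tau> (\<lambda>p. h - l_lin (coroot D \<beta>) p) \<noteq> 0"
  using surj_z_lin[OF pairing_coroot[OF assms]] surj_l_lin[OF pairing_coroot[OF assms]]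
  by (simp_all add: theta_mero_nonzero Im_\<tau> mholomorphic_on_z_lin mholomorphic_on_l_lin
      mholomorphic_on_const_minus surj_const_minus)

lemma lead_coeff_nonzero: "\<beta> \<in> roots D \<Longrightarrow> lead_coeff \<beta> \<noteq> 0"
  by (simp add: lead_coeff_def theta_root_nonzero)

text \<open>One action moves the z-arguments and the other the \<lambda>-arguments, so only together
  do they turn \<beta> into s_\<alpha> \<beta>; the \<lambda>-half is
  \<open>coroot_reflection\<close>.\<close>

lemma lead_coeff_reflection:
  assumes \<alpha>: "\<alpha> \<in> roots D" and \<beta>: "\<beta> \<in> roots D"
  shows "act_z (s \<alpha>) (act_d (s \<alpha>) (lead_coeff \<beta>)) = lead_coeff (s \<alpha> *v \<beta>)"
proof -
  have inv: "invertible (s \<alpha>)" using weyl_is_invertible[OF reflection_weyl[OF \<alpha>]] .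
  have z: "z_lin \<mu> (x, cmat w *v y) = z_lin \<mu> (x, y)" for \<mu> x y and w :: "int ^ 'n ^ 'n"
    by (rule z_lin_snd)
  have l: "l_lin \<nu> (transpose (cmat w) *v x, y) = l_lin \<nu> (x, y)" for \<nu> x y and w :: "int ^ 'n ^ 'n"
    by (rule l_lin_fst)
  have d: "act_d (s \<alpha>) (theta_mero \<tau> (z_lin \<beta>)) = theta_mero \<tau> (z_lin \<beta>)"
    "act_d (s \<alpha>) (theta_mero \<tau> (\<lambda>p. h - z_lin \<beta> p)) = theta_mero \<tau> (\<lambda>p. h - z_lin \<beta> p)"
    "act_d (s \<alpha>) (theta_mero \<tau> (l_lin (coroot D \<beta>))) = theta_mero \<tau> (l_lin (coroot D (s \<alpha> *v \<beta>)))"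
    "act_d (s \<alpha>) (theta_mero \<tau> (\<lambda>p. h - l_lin (coroot D \<beta>) p)) =
      theta_mero \<tau> (\<lambda>p. h - l_lin (coroot D (s \<alpha> *v \<beta>)) p)"
    by (simp_all add: act_d_theta_mero Im_\<tau> inv mholomorphic_on_z_lin mholomorphic_on_l_lin
        mholomorphic_on_const_minus z l_lin_act reflection_inv[OF \<alpha>] coroot_reflection[OF \<alpha> \<beta>])
  have z: "act_z (s \<alpha>) (theta_mero \<tau> (z_lin \<beta>)) = theta_mero \<tau> (z_lin (s \<alpha> *v \<beta>))"
    "act_z (s \<alpha>) (theta_mero \<tau> (\<lambda>p. h - z_lin \<beta> p)) = theta_mero \<tau> (\<lambda>p. h - z_lin (s \<alpha> *v \<beta>) p)"
    "act_z (s \<alpha>) (theta_mero \<tau> (l_lin \<nu>)) = theta_mero \<tau> (l_lin \<nu>)"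
    "act_z (s \<alpha>) (theta_mero \<tau> (\<lambda>p. h - l_lin \<nu> p)) = theta_mero \<tau> (\<lambda>p. h - l_lin \<nu> p)" for \<nu>
    by (simp_all add: act_z_theta_mero Im_\<tau> inv mholomorphic_on_z_lin mholomorphic_on_l_lin
        mholomorphic_on_const_minus l z_lin_act)
  show ?thesis
    unfolding lead_coeff_def by (simp add: act_z_divide act_d_divide act_z_mult act_d_mult inv z d)
qed

lemma T_simple_single:
  assumes "\<alpha> \<in> roots D"
  shows "T_simple \<tau> h D \<alpha> = single (s \<alpha>) (s \<alpha>) (lead_coeff \<alpha>) + single (mat 1) (s \<alpha>) (rest_coeff \<alpha>)"
  using reflection_weyl[OF assms] weyl_one
  by (simp add: T_simple_def Let_def delta_single delta_d_single QWdW_mult_single_single Q_smult_single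
      act_d_1 act_z_1 weyl_is_invertible lead_coeff_def rest_coeff_def)

lemma T_word_Nil: "T_word \<tau> h D [] = single (mat 1) (mat 1) 1"
  by (simp add: T_word_def delta_single)

text \<open>Both terms of the operator carry \<delta>^d_s, so the dynamical index is shifted in
  both, while only the leading term shifts the index of \<delta>. This is why a whole word has a
  single dynamical index.\<close>

lemma T_word_Cons:
  assumes "\<alpha> \<in> roots D"
  shows "T_word \<tau> h D (\<alpha> # \<alpha>s) y x = (if y \<in> W \<and> x \<in> W then
      lead_coeff \<alpha> * act_z (s \<alpha>) (act_d (s \<alpha>) (T_word \<tau> h D \<alpha>s (s \<alpha> ** y) (s \<alpha> ** x)))
      + rest_coeff \<alpha> * act_d (s \<alpha>) (T_word \<tau> h D \<alpha>s y (s \<alpha> ** x)) else 0)"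
proof -
  have "T_word \<tau> h D (\<alpha> # \<alpha>s) y x = QWdW_mult D (T_simple \<tau> h D \<alpha>) (T_word \<tau> h D \<alpha>s) y x"
    by (simp add: T_word_def)
  also have "\<dots> = QWdW_mult D (single (s \<alpha>) (s \<alpha>) (lead_coeff \<alpha>)) (T_word \<tau> h D \<alpha>s) y x
      + QWdW_mult D (single (mat 1) (s \<alpha>) (rest_coeff \<alpha>)) (T_word \<tau> h D \<alpha>s) y x"
    unfolding T_simple_single[OF assms] QWdW_mult_add_left by (simp add: plus_fun_def)
  finally show ?thesis
    using reflection_weyl[OF assms] weyl_one
    by (simp add: QWdW_mult_single reflection_inv[OF assms] matrix_inv_one)
qed

text \<open>
  Expanding the product, \<open>v\<close> is the product of a subword of the reduced word of \<open>x\<close>; the lifting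
  property of the Bruhat order keeps \<open>v \<le> x\<close> at each step.
\<close>

lemma T_word_support:
  assumes "set \<alpha>s \<subseteq> simple_roots D" "length \<alpha>s = len (word_prod D \<alpha>s)" "T_word \<tau> h D \<alpha>s v x \<noteq> 0"
  shows "x = word_prod D \<alpha>s \<and> bruhat_le D v x"
  using assms
proof (induction \<alpha>s arbitrary: v x)
  case Nil
  then show ?case using bruhat_refl[OF weyl_one] by (auto simp: T_word_Nil single_def split: if_splits)
next
  case (Cons \<alpha> \<alpha>s)
  let ?w = "word_prod D \<alpha>s"
  have \<alpha>: "\<alpha> \<in> simple_roots D" "\<alpha> \<in> roots D" and \<alpha>s: "set \<alpha>s \<subseteq> simple_roots D"
    using Cons.prems simple_root by auto
  have w: "?w \<in> W" using word_prod_weyl[OF \<alpha>s] .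
  have l: "length \<alpha>s = len ?w" "len ?w < len (s \<alpha> ** ?w)"
    using weyl_length_le[OF \<alpha>s] length_simple_reflection_le[OF w \<alpha>(1)] Cons.prems(2) by auto
  note IH = Cons.IH[OF \<alpha>s l(1)]
  have inv: "invertible (s \<alpha>)" using weyl_is_invertible[OF reflection_weyl[OF \<alpha>(2)]] .
  have "T_word \<tau> h D \<alpha>s (s \<alpha> ** v) (s \<alpha> ** x) \<noteq> 0 \<or> T_word \<tau> h D \<alpha>s v (s \<alpha> ** x) \<noteq> 0"
  proof (rule ccontr)
    assume "\<not> ?thesis"
    then show False
      using Cons.prems(3) unfolding T_word_Cons[OF \<alpha>(2)] by (simp add: act_z_0 act_d_0 inv split: if_splits)
  qed
  then have "s \<alpha> ** x = ?w \<and> (bruhat_le D (s \<alpha> ** v) ?w \<or> bruhat_le D v ?w)"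
    using IH by metis
  moreover have "bruhat_le D v (s \<alpha> ** ?w)" if "bruhat_le D (s \<alpha> ** v) ?w"
    using bruhat_lift[OF that \<alpha>(1) l(2)] by (simp add: reflection_involution'[OF \<alpha>(2)])
  moreover have "bruhat_le D v (s \<alpha> ** ?w)" if "bruhat_le D v ?w"
    using bruhat_trans[OF that bruhat_simple_step[OF w \<alpha>(2) l(2)]] .
  ultimately show ?case using reflection_involution'[OF \<alpha>(2), of x] by auto
qed

text \<open>Only the leading term of each letter reaches the top element, and the factors collected
  so far are moved by s_\<alpha>, exactly as the inversion set is.\<close>

lemma T_word_leading:
  assumes "set \<alpha>s \<subseteq> simple_roots D" "length \<alpha>s = len (word_prod D \<alpha>s)"
  shows "T_word \<tau> h D \<alpha>s (word_prod D \<alpha>s) (word_prod D \<alpha>s) =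
    (\<Prod>\<beta>\<in>inversions D (word_prod D \<alpha>s). lead_coeff \<beta>)"
  using assms
proof (induction \<alpha>s)
  case Nil
  have "inversions D (mat 1) = {}" using pos_not_neg by (auto simp: inversions_def matrix_inv_one)
  then show ?case by (simp add: T_word_Nil single_def)
next
  case (Cons \<alpha> \<alpha>s)
  let ?w = "word_prod D \<alpha>s"
  have \<alpha>: "\<alpha> \<in> simple_roots D" "\<alpha> \<in> roots D" and \<alpha>s: "set \<alpha>s \<subseteq> simple_roots D"
    using Cons.prems simple_root by auto
  have w: "?w \<in> W" using word_prod_weyl[OF \<alpha>s] .
  have l: "length \<alpha>s = len ?w" "len ?w < len (s \<alpha> ** ?w)"
    using weyl_length_le[OF \<alpha>s] length_simple_reflection_le[OF w \<alpha>(1)] Cons.prems(2) by auto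
  have inv: "invertible (s \<alpha>)" using weyl_is_invertible[OF reflection_weyl[OF \<alpha>(2)]] .
  \<comment> \<open>The contribution of \<open>rest_coeff\<close>: a nonzero value would place the
    longer element below the shorter one in the Bruhat order.\<close>
  have "T_word \<tau> h D \<alpha>s (s \<alpha> ** ?w) ?w = 0"
  proof (rule ccontr)
    assume "T_word \<tau> h D \<alpha>s (s \<alpha> ** ?w) ?w \<noteq> 0"
    then have "bruhat_le D (s \<alpha> ** ?w) ?w" using T_word_support[OF \<alpha>s l(1)] by blast
    then show False using bruhat_length[of "s \<alpha> ** ?w" ?w] l(2) by fastforce
  qed
  moreover have "s \<alpha> ** ?w \<in> W" using weyl_group.step[OF \<alpha>(2) w] .
  ultimately have "T_word \<tau> h D (\<alpha> # \<alpha>s) (s \<alpha> ** ?w) (s \<alpha> ** ?w) =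
      lead_coeff \<alpha> * act_z (s \<alpha>) (act_d (s \<alpha>) (\<Prod>\<beta>\<in>inversions D ?w. lead_coeff \<beta>))"
    using Cons.IH[OF \<alpha>s l(1)]
    by (simp add: T_word_Cons[OF \<alpha>(2)] reflection_involution'[OF \<alpha>(2)] act_d_0 inv)
  also have "act_z (s \<alpha>) (act_d (s \<alpha>) (\<Prod>\<beta>\<in>inversions D ?w. lead_coeff \<beta>)) =
      (\<Prod>\<beta>\<in>inversions D ?w. lead_coeff (s \<alpha> *v \<beta>))"
    unfolding act_d_prod[OF inv] act_z_prod[OF inv]
    by (intro prod.cong refl lead_coeff_reflection \<alpha>(2)) (simp add: inversions_def pos_root)
  also have "\<dots> = (\<Prod>\<beta>\<in>(*v) (s \<alpha>) ` inversions D ?w. lead_coeff \<beta>)"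
    by (subst prod.reindex) (auto intro!: inj_onI dest: arg_cong[of _ _ "(*v) (s \<alpha>)"]
        simp: reflection_involution_apply[OF \<alpha>(2)])
  also have "lead_coeff \<alpha> * \<dots> = (\<Prod>\<beta>\<in>inversions D (s \<alpha> ** ?w). lead_coeff \<beta>)"
    unfolding inversions_simple_mult(1)[OF w \<alpha>(1) l(2)]
    using inversions_simple_mult(2)[OF w \<alpha>(1) l(2)] finite_inversions by simp
  finally show ?case by simp
qed

end

section \<open>Inversion of triangular matrices\<close>

text \<open>Forward substitution, one row at a time by induction on the rank, with \<open>R\<close>
  as the order and \<open>A w v\<close> nonzero only for v below w.\<close>

lemma triangular_left_inverse:
  fixes A :: "'a \<Rightarrow> 'a \<Rightarrow> 'f::field" and rank :: "'a \<Rightarrow> nat"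
  assumes fin: "finite I"
    and refl: "\<And>w. w \<in> I \<Longrightarrow> R w w"
    and trans: "\<And>u v w. R u v \<Longrightarrow> R v w \<Longrightarrow> R u w"
    and rank: "\<And>v w. R v w \<Longrightarrow> v \<noteq> w \<Longrightarrow> rank v < rank w"
    and supp: "\<And>v w. v \<in> I \<Longrightarrow> w \<in> I \<Longrightarrow> \<not> R v w \<Longrightarrow> A w v = 0"
    and diag: "\<And>w. w \<in> I \<Longrightarrow> A w w \<noteq> 0"
  shows "\<exists>B. (\<forall>w\<in>I. \<forall>v\<in>I. \<not> R v w \<longrightarrow> B w v = 0) \<and>
    (\<forall>w\<in>I. \<forall>u\<in>I. (\<Sum>v\<in>I. B w v * A v u) = (if w = u then 1 else 0)) \<and>
    (\<forall>w\<in>I. B w w * A w w = 1)"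
proof -
  define P where "P = (\<lambda>w r. (\<forall>v\<in>I. \<not> R v w \<longrightarrow> r v = 0) \<and>
    (\<forall>u\<in>I. (\<Sum>v\<in>I. r v * A v u) = (if w = u then 1 else 0)))"
  have "\<exists>r. P w r" if "w \<in> I" for w
    using that
  proof (induction "rank w" arbitrary: w rule: less_induct)
    case less
    define L where "L = {v\<in>I. R v w \<and> v \<noteq> w}"
    have "\<forall>v\<in>L. \<exists>r. P v r" using less.hyps rank by (auto simp: L_def)
    then obtain r where r: "\<And>v. v \<in> L \<Longrightarrow> P v (r v)" by metis
    \<comment> \<open>The row that solves \<open>A B = 1\<close> in row w. Multiplying it by
      \<open>A\<close> from the right turns the rows of smaller rank into unit vectors, which cancel
      the off-diagonal entries of row w of \<open>A\<close>.\<close>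
    define row where "row = (\<lambda>x. ((if x = w then 1 else 0) - (\<Sum>v\<in>L. A w v * r v x)) / A w w)"
    have "row x = 0" if x: "x \<in> I" "\<not> R x w" for x
    proof -
      have "r v x = 0" if "v \<in> L" for v
        using r[OF that] that x trans unfolding P_def L_def by blast
      moreover have "x \<noteq> w" using x refl by blast
      ultimately show ?thesis by (simp add: row_def)
    qed
    moreover have "(\<Sum>x\<in>I. row x * A x u) = (if w = u then 1 else 0)" if u: "u \<in> I" for u
    proof -
      have "(\<Sum>x\<in>I. (if x = w then 1 else 0) * A x u) = (\<Sum>x\<in>I. if x = w then A w u else 0)"
        by (intro sum.cong) auto
      also have "\<dots> = A w u" using fin less.prems by simp
      finally have 1: "(\<Sum>x\<in>I. (if x = w then 1 else 0) * A x u) = A w u" .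
      have "(\<Sum>x\<in>I. (\<Sum>v\<in>L. A w v * r v x) * A x u) = (\<Sum>v\<in>L. (\<Sum>x\<in>I. A w v * (r v x * A x u)))"
        unfolding sum_distrib_right mult.assoc by (rule sum.swap)
      also have "\<dots> = (\<Sum>v\<in>L. A w v * (if v = u then 1 else 0))"
        unfolding sum_distrib_left[symmetric] using r u by (intro sum.cong) (simp_all add: P_def)
      also have "\<dots> = (\<Sum>v\<in>L. if v = u then A w u else 0)"
        by (intro sum.cong) auto
      also have "\<dots> = (if u \<in> L then A w u else 0)" using fin by (simp add: L_def)
      finally have 2: "(\<Sum>x\<in>I. (\<Sum>v\<in>L. A w v * r v x) * A x u) = (if u \<in> L then A w u else 0)" .
      have "(\<Sum>x\<in>I. row x * A x u) = (A w u - (if u \<in> L then A w u else 0)) / A w w"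
        unfolding row_def times_divide_eq_left sum_divide_distrib[symmetric] left_diff_distrib
          sum_subtractf 1 2 ..
      also have "\<dots> = (if w = u then 1 else 0)"
        using diag[OF less.prems] supp[OF u less.prems] u by (auto simp: L_def)
      finally show ?thesis .
    qed
    ultimately show ?case unfolding P_def by blast
  qed
  then obtain B where B: "\<And>w. w \<in> I \<Longrightarrow> P w (B w)" by metis
  have "B w w * A w w = 1" if w: "w \<in> I" for w
  proof -
    \<comment> \<open>A nonzero product needs v below w and w below v, which the strict growth of
      the rank permits only for v = w.\<close>
    have "B w v * A v w = (if v = w then B w w * A w w else 0)" if v: "v \<in> I" for v
    proof (cases "R v w \<and> R w v")
      case True
      then have "v = w" using rank[of v w] rank[of w v] by force
      then show ?thesis by simp
    next
      case False
      then have "B w v * A v w = 0" using B[OF w] supp[OF w v] v unfolding P_def by auto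
      then show ?thesis using False refl[OF w] by auto
    qed
    then have "(\<Sum>v\<in>I. B w v * A v w) = (\<Sum>v\<in>I. if v = w then B w w * A w w else 0)"
      by (intro sum.cong) auto
    then show ?thesis using B[OF w] w fin unfolding P_def by simp
  qed
  then show ?thesis using B unfolding P_def by (intro exI[of _ B]) simp
qed

text \<open>A left inverse of a triangular matrix is triangular with nonzero diagonal, so it has a left inverse too.\<close>

lemma triangular_inverse:
  fixes A :: "'a \<Rightarrow> 'a \<Rightarrow> 'f::field" and rank :: "'a \<Rightarrow> nat"
  assumes fin: "finite I"
    and refl: "\<And>w. w \<in> I \<Longrightarrow> R w w"
    and trans: "\<And>u v w. R u v \<Longrightarrow> R v w \<Longrightarrow> R u w"
    and rank: "\<And>v w. R v w \<Longrightarrow> v \<noteq> w \<Longrightarrow> rank v < rank w"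
    and supp: "\<And>v w. v \<in> I \<Longrightarrow> w \<in> I \<Longrightarrow> \<not> R v w \<Longrightarrow> A w v = 0"
    and diag: "\<And>w. w \<in> I \<Longrightarrow> A w w \<noteq> 0"
  shows "\<exists>B. (\<forall>w\<in>I. \<forall>v\<in>I. \<not> R v w \<longrightarrow> B w v = 0) \<and>
    (\<forall>w\<in>I. \<forall>u\<in>I. (\<Sum>v\<in>I. B w v * A v u) = (if w = u then 1 else 0)) \<and>
    (\<forall>w\<in>I. \<forall>u\<in>I. (\<Sum>v\<in>I. A w v * B v u) = (if w = u then 1 else 0)) \<and>
    (\<forall>w\<in>I. B w w = inverse (A w w))"
proof -
  have "\<exists>B. (\<forall>w\<in>I. \<forall>v\<in>I. \<not> R v w \<longrightarrow> B w v = 0) \<and>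
      (\<forall>w\<in>I. \<forall>u\<in>I. (\<Sum>v\<in>I. B w v * A v u) = (if w = u then 1 else 0)) \<and>
      (\<forall>w\<in>I. B w w * A w w = 1)"
    by (rule triangular_left_inverse[where rank = rank]) (fact assms)+
  then obtain B where B: "\<forall>w\<in>I. \<forall>v\<in>I. \<not> R v w \<longrightarrow> B w v = 0"
    and BA: "\<forall>w\<in>I. \<forall>u\<in>I. (\<Sum>v\<in>I. B w v * A v u) = (if w = u then 1 else 0)"
    and Bd: "\<forall>w\<in>I. B w w * A w w = 1"
    by (elim exE conjE)
  have B': "\<And>v w. v \<in> I \<Longrightarrow> w \<in> I \<Longrightarrow> \<not> R v w \<Longrightarrow> B w v = 0"
    using B by simp
  have B0: "\<And>w. w \<in> I \<Longrightarrow> B w w \<noteq> 0"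
    using Bd by fastforce
  have "\<exists>C. (\<forall>w\<in>I. \<forall>v\<in>I. \<not> R v w \<longrightarrow> C w v = 0) \<and>
      (\<forall>w\<in>I. \<forall>u\<in>I. (\<Sum>v\<in>I. C w v * B v u) = (if w = u then 1 else 0)) \<and>
      (\<forall>w\<in>I. C w w * B w w = 1)"
    by (rule triangular_left_inverse[where rank = rank]) (fact assms B' B0)+
  then obtain C where CB: "\<forall>w\<in>I. \<forall>u\<in>I. (\<Sum>v\<in>I. C w v * B v u) = (if w = u then 1 else 0)"
    by (elim exE conjE)
  \<comment> \<open>C = C (B A) = (C B) A = A, so the left inverse of \<open>B\<close> is
    \<open>A\<close> itself.\<close>
  have CA: "C w t = A w t" if w: "w \<in> I" and t: "t \<in> I" for w t
  proof -
    have "C w t = (\<Sum>u\<in>I. C w u * (if u = t then 1 else 0))"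
      using t fin by (simp add: if_distrib[of "(*) _"] cong: if_cong)
    also have "\<dots> = (\<Sum>u\<in>I. C w u * (\<Sum>v\<in>I. B u v * A v t))"
      using t by (simp add: BA)
    also have "\<dots> = (\<Sum>v\<in>I. (\<Sum>u\<in>I. C w u * B u v) * A v t)"
      unfolding sum_distrib_left sum_distrib_right mult.assoc by (rule sum.swap)
    also have "\<dots> = (\<Sum>v\<in>I. if v = w then A w t else 0)"
      using w by (intro sum.cong) (auto simp: CB)
    also have "\<dots> = A w t" using w fin by simp
    finally show ?thesis .
  qed
  have "(\<Sum>v\<in>I. A w v * B v u) = (if w = u then 1 else 0)" if "w \<in> I" "u \<in> I" for w u
    using CB that by (simp add: CA)
  moreover have "B w w = inverse (A w w)" if "w \<in> I" for w
    using Bd that by (metis inverse_unique mult.commute)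
  ultimately show ?thesis using B BA by (intro exI[of _ B]) simp
qed

section \<open>Transition coefficients and basis property\<close>

locale elliptic_reduced_words = elliptic_root_datum D \<tau> h
  for D :: "('n::finite) root_datum" and \<tau> h +
  fixes rw :: "int ^ 'n ^ 'n \<Rightarrow> (int ^ 'n) list"
  assumes reduced: "w \<in> W \<Longrightarrow> reduced_word D (rw w) w"
begin

definition T :: "int ^ 'n ^ 'n \<Rightarrow> 'n bitwisted" where
  "T w = T_word \<tau> h D (rw w)"

text \<open>The coefficients of \<open>\<delta>\<^sup>d\<close> at \<open>w\<^sup>-\<^sup>1\<close> times \<open>T\<^sub>w\<close>, which has no dynamical part.\<close>

definition A :: "int ^ 'n ^ 'n \<Rightarrow> int ^ 'n ^ 'n \<Rightarrow> 'n mero" where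
  "A w v = act_d (matrix_inv w) (T w v w)"

lemma T_support:
  assumes "w \<in> W" "T w v x \<noteq> 0"
  shows "x = w" "bruhat_le D v w"
  using T_word_support[of "rw w" v x] reduced[OF assms(1)] assms(2) by (auto simp: T_def reduced_word_def)

lemma T_zero: "w \<in> W \<Longrightarrow> \<not> bruhat_le D v w \<Longrightarrow> T w v x = 0"
  using T_support(2) by blast

lemma T_leading: "w \<in> W \<Longrightarrow> T w w w = (\<Prod>\<beta>\<in>inversions D w. lead_coeff \<beta>)"
  using T_word_leading[of "rw w"] reduced[of w] by (auto simp: T_def reduced_word_def)

lemma T_leading_nonzero: "w \<in> W \<Longrightarrow> T w w w \<noteq> 0"
proof -
  assume w: "w \<in> W"
  have "lead_coeff \<beta> \<noteq> 0" if "\<beta> \<in> inversions D w" for \<beta>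
    using that by (intro lead_coeff_nonzero pos_root) (simp add: inversions_def)
  then show ?thesis by (simp add: T_leading[OF w] prod_zero_iff[OF finite_inversions])
qed

lemma act_d_A: "w \<in> W \<Longrightarrow> act_d w (A w v) = T w v w"
  by (simp add: A_def act_d_compose weyl_is_invertible weyl_inv weyl_inv_right)

lemma A_support: "w \<in> W \<Longrightarrow> \<not> bruhat_le D v w \<Longrightarrow> A w v = 0"
  by (simp add: A_def T_zero act_d_0 weyl_is_invertible weyl_inv)

lemma A_diag: "w \<in> W \<Longrightarrow> A w w \<noteq> 0"
  by (simp add: A_def act_d_eq_0_iff weyl_is_invertible weyl_inv T_leading_nonzero)

lemma T_expansion:
  assumes w: "w \<in> W"
  shows "T w = (\<Sum>v | bruhat_le D v w. Q_smult (T w v w) (QWdW_mult D (delta_d w) (delta v)))"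
proof (intro ext)
  fix y x
  have "(\<Sum>v | bruhat_le D v w. Q_smult (T w v w) (QWdW_mult D (delta_d w) (delta v))) y x =
      (\<Sum>v | bruhat_le D v w. single v w (T w v w) y x)"
    unfolding bitwisted_sum_apply
    using w weyl_one by (intro sum.cong) (auto simp: delta_single delta_d_single QWdW_mult_single_single
        Q_smult_single act_z_1 act_d_1 weyl_is_invertible dest: bruhat_weyl)
  also have "\<dots> = (\<Sum>v | bruhat_le D v w. if v = y then (if x = w then T w y w else 0) else 0)"
    by (intro sum.cong) (auto simp: single_def)
  also have "\<dots> = (if bruhat_le D y w \<and> x = w then T w y w else 0)"
    using finite_bruhat by simp
  also have "\<dots> = T w y x" using T_support[OF w, of y x] by auto
  finally show "T w y x =
    (\<Sum>v | bruhat_le D v w. Q_smult (T w v w) (QWdW_mult D (delta_d w) (delta v))) y x" ..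
qed

text \<open>Left multiplication by the inverse dynamical element cancels the single dynamical index
  of \<open>T v\<close> and acts on its coefficients, which is how \<open>A\<close> arises.\<close>

lemma delta_d_T:
  assumes v: "v \<in> W"
  shows "QWdW_mult D (delta_d (matrix_inv v)) (T v) y x = (if y \<in> W \<and> x = mat 1 then A v y else 0)"
proof -
  have "T v y (v ** x) = (if x = mat 1 then T v y v else 0)"
  proof (cases "T v y (v ** x) = 0")
    case False
    then have "v ** x = v" by (rule T_support(1)[OF v])
    then have "x = mat 1" using weyl_inv_left'[OF v, of x] weyl_inv_left[OF v] by simp
    then show ?thesis by simp
  qed auto
  then show ?thesis
    using v weyl_one by (auto simp: delta_d_single QWdW_mult_single weyl_inv weyl_inv_inv matrix_inv_one
        A_def act_d_0 weyl_is_invertible)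
qed

text \<open>The dynamical action fixes the factors in z, so only the \<lambda>-part stays under it;
  this is the shape of the factors of b_{w,w}.\<close>

lemma act_d_lead_coeff:
  assumes w: "w \<in> W" and \<beta>: "\<beta> \<in> roots D"
  shows "inverse (act_d w (lead_coeff \<beta>)) = theta_mero \<tau> (z_lin \<beta>) / theta_mero \<tau> (\<lambda>p. h - z_lin \<beta> p)
    * act_d w (theta_mero \<tau> (\<lambda>p. h - l_lin (coroot D \<beta>) p) / theta_mero \<tau> (l_lin (coroot D \<beta>)))"
proof -
  note inv = weyl_is_invertible[OF w]
  have z: "z_lin \<mu> (x, cmat u *v y) = z_lin \<mu> (x, y)" for \<mu> x y and u :: "int ^ 'n ^ 'n"
    by (rule z_lin_snd)
  have "act_d w (theta_mero \<tau> (z_lin \<beta>)) = theta_mero \<tau> (z_lin \<beta>)"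
    "act_d w (theta_mero \<tau> (\<lambda>p. h - z_lin \<beta> p)) = theta_mero \<tau> (\<lambda>p. h - z_lin \<beta> p)"
    by (simp_all add: act_d_theta_mero Im_\<tau> inv mholomorphic_on_z_lin mholomorphic_on_const_minus z)
  then show ?thesis
    by (simp add: lead_coeff_def act_d_mult act_d_inverse inv divide_inverse mult_ac)
qed

text \<open>Since \<open>T w\<close> lives at the dynamical index w alone, only the term of
  \<open>c\<close> at x w^-1 contributes at x, and the action of x w^-1 on the coefficient of
  \<open>T w\<close> is the action of x on \<open>A w v\<close>.\<close>

lemma QWd_smult_T:
  assumes w: "w \<in> W"
  shows "QWd_smult D c (T w) v x =
    (if x \<in> W then c (x ** matrix_inv w) * act_d x (A w v) else 0)"
proof (cases "x \<in> W")
  case True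
  let ?y = "x ** matrix_inv w"
  have y: "?y \<in> W" using True w weyl_inv weyl_group_mult by blast
  have "T w v (matrix_inv u ** x) = 0" if "u \<in> W" "u \<noteq> ?y" for u
  proof (rule ccontr)
    assume "T w v (matrix_inv u ** x) \<noteq> 0"
    then have "x = u ** w" using T_support(1)[OF w] weyl_inv_right'[OF that(1), of x] by metis
    then show False using that(2) by (simp add: matrix_mul_assoc[symmetric] weyl_inv_right[OF w])
  qed
  then have "QWd_smult D c (T w) v x =
      (\<Sum>u\<in>W. if u = ?y then c ?y * act_d ?y (T w v (matrix_inv ?y ** x)) else 0)"
    using True unfolding QWd_smult_def QWd_mult_def sum_factorizations
    by (auto intro!: sum.cong simp: act_d_0 weyl_is_invertible)
  also have "\<dots> = c ?y * act_d ?y (T w v (matrix_inv ?y ** x))"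
    using y finite_weyl_group by simp
  also have "matrix_inv ?y ** x = w"
    using True w by (simp add: weyl_inv_mult weyl_inv weyl_inv_inv matrix_mul_assoc[symmetric] weyl_inv_left)
  also have "act_d ?y (T w v w) = act_d x (A w v)"
    using True w by (simp add: A_def act_d_compose weyl_is_invertible weyl_inv)
  finally show ?thesis using True by simp
next
  case False
  then show ?thesis unfolding QWd_smult_def QWd_mult_def sum_factorizations by simp
qed

lemma T_in_QWdW:
  assumes w: "w \<in> W"
  shows "T w \<in> QWdW D"
proof -
  have "T w v x = 0" if "v \<notin> W \<or> x \<notin> W" for v x
    using T_support[OF w, of v x] bruhat_weyl[of v w] w that by blast
  then show ?thesis unfolding QWdW_def QWd_def by (auto simp: zero_fun_def)
qed

text \<open>The dynamical index of a nonzero coefficient recovers w. Sums over the set of operators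
  can thus be indexed by the Weyl group.\<close>

lemma inj_on_T: "inj_on T W"
proof (rule inj_onI)
  fix v w assume "v \<in> W" "w \<in> W" "T v = T w"
  then show "v = w" using T_leading_nonzero[of v] T_support(1)[of w v v] by simp
qed

lemma inverse_coefficients:
  "\<exists>b. (\<forall>w\<in>W. \<forall>v\<in>W. \<not> bruhat_le D v w \<longrightarrow> b w v = 0) \<and>
    (\<forall>w\<in>W. \<forall>u\<in>W. (\<Sum>v\<in>W. b w v * A v u) = (if w = u then 1 else 0)) \<and>
    (\<forall>w\<in>W. \<forall>u\<in>W. (\<Sum>v\<in>W. A w v * b v u) = (if w = u then 1 else 0)) \<and>
    (\<forall>w\<in>W. b w w = inverse (A w w))"
proof (rule triangular_inverse[where rank = len])
  show "\<And>u v w. bruhat_le D u v \<Longrightarrow> bruhat_le D v w \<Longrightarrow> bruhat_le D u w" by (rule bruhat_trans)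
  show "\<And>v w. bruhat_le D v w \<Longrightarrow> v \<noteq> w \<Longrightarrow> len v < len w" by (rule bruhat_length)
qed (simp_all add: finite_weyl_group bruhat_refl A_support A_diag)

text \<open>
  For fixed \<open>x\<close>, the coefficients of \<open>\<Sum>\<^sub>w c\<^sub>w T\<^sub>w\<close> at \<open>\<delta>\<^sup>d\<^sub>x \<delta>\<^sub>v\<close> are the row vector with
  entries \<open>c\<^sub>w(x w\<^sup>-\<^sup>1)\<close> times the image of the matrix \<^const>\<open>A\<close> under \<open>x\<close>. Both halves of the basis
  property thus reduce to the invertibility of \<^const>\<open>A\<close>.
\<close>

lemma left_basis_T: "left_basis D (T ` W)"
proof -
  obtain b where bA: "\<forall>w\<in>W. \<forall>u\<in>W. (\<Sum>v\<in>W. b w v * A v u) = (if w = u then 1 else 0)"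
    and Ab: "\<forall>w\<in>W. \<forall>u\<in>W. (\<Sum>v\<in>W. A w v * b v u) = (if w = u then 1 else 0)"
    using inverse_coefficients by (elim exE conjE)
  have act_delta: "act_d x (if P then 1 else 0) = (if P then 1 else 0)" if "x \<in> W" for x P
    by (simp add: act_d_0 act_d_1 weyl_is_invertible[OF that])
  have span: "\<exists>S c. finite S \<and> S \<subseteq> T ` W \<and> (\<forall>x\<in>S. c x \<in> QWd D) \<and> F = (\<Sum>x\<in>S. QWd_smult D (c x) x)"
    if F: "F \<in> QWdW D" for F
  proof -
    have F0: "F v x = 0" if "v \<notin> W \<or> x \<notin> W" for v x
      using F that unfolding QWdW_def QWd_def by (cases "v \<in> W") (auto simp: zero_fun_def)
    \<comment> \<open>Solves the row equation at x by multiplying with the image of \<open>b\<close>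
      under x from the right; since the unknown is evaluated at y = x w^-1, x becomes
      \<open>y ** w\<close>.\<close>
    define C where "C = (\<lambda>w y. if y \<in> W then \<Sum>u\<in>W. F u (y ** w) * act_d (y ** w) (b u w) else 0)"
    define c where "c = (\<lambda>X. C (inv_into W T X))"
    have "F v x = (\<Sum>X\<in>T ` W. QWd_smult D (c X) X) v x" for v x
    proof -
      have "(\<Sum>X\<in>T ` W. QWd_smult D (c X) X) v x = (\<Sum>w\<in>W. QWd_smult D (C w) (T w) v x)"
        unfolding bitwisted_sum_apply sum.reindex[OF inj_on_T]
        by (intro sum.cong) (simp_all add: c_def inv_into_f_f[OF inj_on_T])
      also have "\<dots> = F v x"
      proof (cases "x \<in> W \<and> v \<in> W")
        case True
        then have x: "x \<in> W" and v: "v \<in> W" by auto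
        have "C w (x ** matrix_inv w) = (\<Sum>u\<in>W. F u x * act_d x (b u w))" if "w \<in> W" for w
          using weyl_group_mult[OF x weyl_inv[OF that]] that
          by (simp add: C_def matrix_mul_assoc[symmetric] weyl_inv_left)
        then have "(\<Sum>w\<in>W. QWd_smult D (C w) (T w) v x) =
            (\<Sum>w\<in>W. (\<Sum>u\<in>W. F u x * act_d x (b u w)) * act_d x (A w v))"
          using x by (intro sum.cong) (simp_all add: QWd_smult_T)
        also have "\<dots> = (\<Sum>u\<in>W. F u x * act_d x (\<Sum>w\<in>W. b u w * A w v))"
          unfolding sum_distrib_left sum_distrib_right mult.assoc act_d_sum[OF weyl_is_invertible[OF x]]
            act_d_mult[OF weyl_is_invertible[OF x]] by (rule sum.swap)
        also have "\<dots> = (\<Sum>u\<in>W. if u = v then F v x else 0)"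
          using v x by (intro sum.cong) (auto simp: bA act_delta)
        also have "\<dots> = F v x" using v finite_weyl_group by simp
        finally show ?thesis .
      next
        case False
        have "QWd_smult D (C w) (T w) v x = 0" if "w \<in> W" for w
        proof (cases "x \<in> W")
          case True
          then have "\<not> bruhat_le D v w" using False bruhat_weyl by blast
          then show ?thesis
            using True that by (simp add: QWd_smult_T A_support act_d_0 weyl_is_invertible)
        qed (simp add: QWd_smult_T that)
        moreover have "F v x = 0" using F0 False by blast
        ultimately show ?thesis by simp
      qed
      finally show ?thesis ..
    qed
    then have "F = (\<Sum>X\<in>T ` W. QWd_smult D (c X) X)" by (intro ext)
    moreover have "\<forall>X\<in>T ` W. c X \<in> QWd D" by (simp add: c_def C_def QWd_def)
    ultimately show ?thesis using finite_weyl_group by blast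
  qed
  have independent: "\<forall>X\<in>S. c X = 0"
    if S: "finite S" "S \<subseteq> T ` W" and c: "\<forall>X\<in>S. c X \<in> QWd D"
      and zero: "(\<Sum>X\<in>S. QWd_smult D (c X) X) = 0" for S c
  proof
    fix X assume "X \<in> S"
    then obtain u where u: "u \<in> W" "X = T u" using S by blast
    \<comment> \<open>The coefficients \<open>c\<close>, extended by zero from \<open>S\<close> to
      all operators.\<close>
    define d where "d = (\<lambda>w y. if T w \<in> S then c (T w) y else 0)"
    have sum0: "(\<Sum>w\<in>W. d w (x ** matrix_inv w) * act_d x (A w v)) = 0" if x: "x \<in> W" for x v
    proof -
      have "(\<Sum>w\<in>W. d w (x ** matrix_inv w) * act_d x (A w v)) =
          (\<Sum>w\<in>W. if T w \<in> S then QWd_smult D (c (T w)) (T w) v x else 0)"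
        using x by (intro sum.cong) (simp_all add: d_def QWd_smult_T)
      also have "\<dots> = (\<Sum>Y\<in>T ` W. if Y \<in> S then QWd_smult D (c Y) Y v x else 0)"
        by (simp add: sum.reindex[OF inj_on_T])
      also have "\<dots> = (\<Sum>Y\<in>S. QWd_smult D (c Y) Y v x)"
        using S finite_weyl_group by (intro sum.mono_neutral_cong_right) auto
      also have "\<dots> = 0"
        using fun_cong[OF fun_cong[OF zero, of v], of x] by (simp add: bitwisted_sum_apply zero_fun_def)
      finally show ?thesis .
    qed
    have "c X y = 0" for y
    proof (cases "y \<in> W")
      case True
      \<comment> \<open>Chosen so that the entry for u in the row at x, namely d u (x u^-1), is the
        coefficient at y; column u of the image of A b = 1 under x isolates it.\<close>
      define x where "x = y ** u"
      have x: "x \<in> W" unfolding x_def using True u weyl_group_mult by blast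
      have "0 = (\<Sum>v\<in>W. (\<Sum>w\<in>W. d w (x ** matrix_inv w) * act_d x (A w v)) * act_d x (b v u))"
        using sum0[OF x] by simp
      also have "\<dots> = (\<Sum>w\<in>W. d w (x ** matrix_inv w) * act_d x (\<Sum>v\<in>W. A w v * b v u))"
        unfolding sum_distrib_left sum_distrib_right mult.assoc act_d_sum[OF weyl_is_invertible[OF x]]
          act_d_mult[OF weyl_is_invertible[OF x]] by (rule sum.swap)
      also have "\<dots> = (\<Sum>w\<in>W. if w = u then d u (x ** matrix_inv u) else 0)"
        using u x by (intro sum.cong) (auto simp: Ab act_delta)
      also have "\<dots> = d u (x ** matrix_inv u)" using u finite_weyl_group by simp
      also have "x ** matrix_inv u = y"
        by (simp add: x_def matrix_mul_assoc[symmetric] weyl_inv_right[OF u(1)])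
      finally show ?thesis using \<open>X \<in> S\<close> u by (simp add: d_def)
    next
      case False
      then show ?thesis using c \<open>X \<in> S\<close> unfolding QWd_def by blast
    qed
    then show "c X = 0" by (intro ext) (simp add: zero_fun_def)
  qed
  show ?thesis
    unfolding left_basis_def using T_in_QWdW span independent by blast
qed

end

theorem theorem2p4:
  fixes D :: "('n::finite) root_datum" and \<tau> h :: complex
    and rw :: "int ^ 'n ^ 'n \<Rightarrow> (int ^ 'n) list"
  assumes "based_root_datum D" and "Im \<tau> > 0"
    and "\<And>w. w \<in> weyl_group D \<Longrightarrow> reduced_word D (rw w) w"
  shows "(\<exists>a b :: int ^ 'n ^ 'n \<Rightarrow> int ^ 'n ^ 'n \<Rightarrow> 'n mero.
      (\<forall>w\<in>weyl_group D. \<forall>v\<in>weyl_group D. \<not> bruhat_le D v w \<longrightarrow> a w v = 0 \<and> b w v = 0) \<and>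
      (\<forall>w\<in>weyl_group D.
         T_word \<tau> h D (rw w) =
           (\<Sum>v | bruhat_le D v w. Q_smult (a w v) (QWdW_mult D (delta_d w) (delta v))) \<and>
         delta w =
           (\<Sum>v | bruhat_le D v w.
              Q_smult (b w v) (QWdW_mult D (delta_d (matrix_inv v)) (T_word \<tau> h D (rw v))))) \<and>
      (\<forall>w\<in>weyl_group D. \<forall>u\<in>weyl_group D.
         (\<Sum>v\<in>weyl_group D. a w v * act_d w (b v u)) = (if w = u then 1 else 0) \<and>
         (\<Sum>v\<in>weyl_group D. b w v * act_d (matrix_inv v) (a v u)) = (if w = u then 1 else 0)) \<and>
      (\<forall>w\<in>weyl_group D.
         a w w = (\<Prod>\<alpha>\<in>inversions D w.
           theta_mero \<tau> (\<lambda>p. h - z_lin \<alpha> p) * theta_mero \<tau> (l_lin (coroot D \<alpha>))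
           / (theta_mero \<tau> (z_lin \<alpha>) * theta_mero \<tau> (\<lambda>p. h - l_lin (coroot D \<alpha>) p))) \<and>
         b w w = (\<Prod>\<alpha>\<in>inversions D w.
           theta_mero \<tau> (z_lin \<alpha>) / theta_mero \<tau> (\<lambda>p. h - z_lin \<alpha> p)
           * act_d (matrix_inv w)
               (theta_mero \<tau> (\<lambda>p. h - l_lin (coroot D \<alpha>) p) / theta_mero \<tau> (l_lin (coroot D \<alpha>))))))
    \<and> inj_on (\<lambda>w. T_word \<tau> h D (rw w)) (weyl_group D)
    \<and> left_basis D ((\<lambda>w. T_word \<tau> h D (rw w)) ` weyl_group D)"
proof -
  interpret elliptic_reduced_words D \<tau> h rw
    using assms by unfold_locales blast+
  obtain b where b: "\<forall>w\<in>W. \<forall>v\<in>W. \<not> bruhat_le D v w \<longrightarrow> b w v = 0"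
    and bA: "\<forall>w\<in>W. \<forall>u\<in>W. (\<Sum>v\<in>W. b w v * A v u) = (if w = u then 1 else 0)"
    and Ab: "\<forall>w\<in>W. \<forall>u\<in>W. (\<Sum>v\<in>W. A w v * b v u) = (if w = u then 1 else 0)"
    and b_diag: "\<forall>w\<in>W. b w w = inverse (A w w)"
    using inverse_coefficients by (elim exE conjE)
  have T_eq: "T_word \<tau> h D (rw w) = T w" for w by (simp add: T_def)
  have delta: "delta w = (\<Sum>v | bruhat_le D v w. Q_smult (b w v) (QWdW_mult D (delta_d (matrix_inv v)) (T v)))"
    if w: "w \<in> W" for w
  proof (intro ext)
    fix y x
    have "(\<Sum>v | bruhat_le D v w. Q_smult (b w v) (QWdW_mult D (delta_d (matrix_inv v)) (T v))) y x =
        (\<Sum>v | bruhat_le D v w. b w v * (if y \<in> W \<and> x = mat 1 then A v y else 0))"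
      unfolding bitwisted_sum_apply
      by (intro sum.cong) (auto simp: Q_smult_def delta_d_T dest: bruhat_weyl)
    also have "\<dots> = (\<Sum>v\<in>W. b w v * (if y \<in> W \<and> x = mat 1 then A v y else 0))"
      using finite_weyl_group b w bruhat_weyl by (intro sum.mono_neutral_left) auto
    also have "\<dots> = delta w y x"
      using bA w by (cases "y \<in> W \<and> x = mat 1") (auto simp: delta_def)
    finally show "delta w y x =
      (\<Sum>v | bruhat_le D v w. Q_smult (b w v) (QWdW_mult D (delta_d (matrix_inv v)) (T v))) y x" ..
  qed
  \<comment> \<open>Applying w to \<open>A b = 1\<close> turns the entries of \<open>A\<close> into
    coefficients of \<open>T w\<close> and leaves the right side fixed.\<close>
  have relation: "(\<Sum>v\<in>W. T w v w * act_d w (b v u)) = (if w = u then 1 else 0)"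
    if w: "w \<in> W" and u: "u \<in> W" for w u
  proof -
    have "(\<Sum>v\<in>W. T w v w * act_d w (b v u)) = act_d w (\<Sum>v\<in>W. A w v * b v u)"
      by (simp add: act_d_sum act_d_mult weyl_is_invertible[OF w] act_d_A[OF w])
    then show ?thesis using w u by (simp add: Ab act_d_0 act_d_1 weyl_is_invertible)
  qed
  have b_diag': "b w w = (\<Prod>\<alpha>\<in>inversions D w.
      theta_mero \<tau> (z_lin \<alpha>) / theta_mero \<tau> (\<lambda>p. h - z_lin \<alpha> p)
      * act_d (matrix_inv w)
          (theta_mero \<tau> (\<lambda>p. h - l_lin (coroot D \<alpha>) p) / theta_mero \<tau> (l_lin (coroot D \<alpha>))))"
    if w: "w \<in> W" for w
  proof -
    have "b w w = (\<Prod>\<alpha>\<in>inversions D w. inverse (act_d (matrix_inv w) (lead_coeff \<alpha>)))"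
      by (simp add: b_diag w A_def T_leading[OF w] act_d_prod weyl_is_invertible weyl_inv w prod_inversef[symmetric] comp_def)
    also have "\<dots> = (\<Prod>\<alpha>\<in>inversions D w.
      theta_mero \<tau> (z_lin \<alpha>) / theta_mero \<tau> (\<lambda>p. h - z_lin \<alpha> p)
      * act_d (matrix_inv w)
          (theta_mero \<tau> (\<lambda>p. h - l_lin (coroot D \<alpha>) p) / theta_mero \<tau> (l_lin (coroot D \<alpha>))))"
      by (intro prod.cong refl act_d_lead_coeff weyl_inv w) (simp add: inversions_def pos_root)
    finally show ?thesis .
  qed
  have "\<exists>a b :: int ^ 'n ^ 'n \<Rightarrow> int ^ 'n ^ 'n \<Rightarrow> 'n mero.
      (\<forall>w\<in>W. \<forall>v\<in>W. \<not> bruhat_le D v w \<longrightarrow> a w v = 0 \<and> b w v = 0) \<and>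
      (\<forall>w\<in>W. T w = (\<Sum>v | bruhat_le D v w. Q_smult (a w v) (QWdW_mult D (delta_d w) (delta v))) \<and>
         delta w = (\<Sum>v | bruhat_le D v w. Q_smult (b w v) (QWdW_mult D (delta_d (matrix_inv v)) (T v)))) \<and>
      (\<forall>w\<in>W. \<forall>u\<in>W. (\<Sum>v\<in>W. a w v * act_d w (b v u)) = (if w = u then 1 else 0) \<and>
         (\<Sum>v\<in>W. b w v * act_d (matrix_inv v) (a v u)) = (if w = u then 1 else 0)) \<and>
      (\<forall>w\<in>W.
         a w w = (\<Prod>\<alpha>\<in>inversions D w.
           theta_mero \<tau> (\<lambda>p. h - z_lin \<alpha> p) * theta_mero \<tau> (l_lin (coroot D \<alpha>))
           / (theta_mero \<tau> (z_lin \<alpha>) * theta_mero \<tau> (\<lambda>p. h - l_lin (coroot D \<alpha>) p))) \<and>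
         b w w = (\<Prod>\<alpha>\<in>inversions D w.
           theta_mero \<tau> (z_lin \<alpha>) / theta_mero \<tau> (\<lambda>p. h - z_lin \<alpha> p)
           * act_d (matrix_inv w)
               (theta_mero \<tau> (\<lambda>p. h - l_lin (coroot D \<alpha>) p) / theta_mero \<tau> (l_lin (coroot D \<alpha>)))))"
  \<comment> \<open>With this choice of a, the twisted entry in the second relation is
    \<open>A v u\<close> by definition, so that relation is \<open>bA\<close>.\<close>
  proof (rule exI[of _ "\<lambda>w v. T w v w"], rule exI[of _ b], intro conjI ballI impI)
    fix w u assume "w \<in> W" "u \<in> W"
    then show "(\<Sum>v\<in>W. b w v * act_d (matrix_inv v) (T v u v)) = (if w = u then 1 else 0)"
      using bA unfolding A_def by blast
  next
    fix w v assume "w \<in> W" "v \<in> W" "\<not> bruhat_le D v w"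
    then show "T w v w = 0" "b w v = 0" using T_zero b by blast+
  qed (simp_all only: delta relation b_diag' T_leading lead_coeff_def T_expansion[symmetric])
  then show ?thesis
    unfolding T_eq using inj_on_T left_basis_T by blast
qed

end
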